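(* Let $n\ge2$, let $q_0\ge0$ and let $\mathbf{P}\colon[q_0,\infty)\to\mathbb{R}^n$ be an $(n,0)$-system. Then there exists a unit vector $\mathbf{u}$ of $\mathbb{R}^n$ such that $\|\mathbf{P}(q)-\mathbf{L}_\mathbf{u}(q)\|_\infty\le3n^2(n+9)$ for each $q\ge q_0$.
   Context: An $(n,0)$-system on $[q_0,\infty)$ is a map $\mathbf{P}=(P_1,\dots,P_n)\colon[q_0,\infty)\to\mathbb{R}^n$ such that: (S1) $0\le P_j(q)\le P_{j+1}(q)$ for $1\le j<n$, $q\ge q_0$; (S2) $P_j(q_1)\le P_j(q_2)$ for $q_0\le q_1\le q_2$; (S3) each $M_j=P_1+\cdots+P_j$ ($1\le j\le n$) is continuous and piecewise linear with slopes $0$ and $1$; (S4) $M_n(q)=q$ for $q\ge q_0$; (S5) if for some $j\in\{1,\dots,n-1\}$, $M_j$ changes slope from $1$ to $0$ at a point $q>q_0$, then $P_{j+1}(q)\le P_j(q)$. For a unit vector $\mathbf{u}$ and $q\ge0$, $\mathcal{C}_\mathbf{u}(e^q)=\{\mathbf{x}\in\mathbb{R}^n:\|\mathbf{x}\|\le1,|\mathbf{x}\cdot\mathbf{u}|\le e^{-q}\}$ (Euclidean norm), $L_{\mathbf{u},j}(q)$ is the smallest $L\ge0$ such that $e^L\mathcal{C}_\mathbf{u}(e^q)$ contains $j$ linearly independent points of $\mathbb{Z}^n$, and $\mathbf{L}_\mathbf{u}=(L_{\mathbf{u},1},\dots,L_{\mathbf{u},n})$. *)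

theory Defs
  imports "HOL-Analysis.Analysis"
begin

text \<open>
  A map \<open>P = (P_1, \<dots>, P_n) : [q0, \<infinity>) \<rightarrow> \<real>^n\<close> is represented by the family of its components,
  \<open>P j q\<close> being the value of the \<open>j\<close>-th component at \<open>q\<close>. Only the values with
  \<open>1 \<le> j \<le> n\<close> and \<open>q \<ge> q0\<close> are ever constrained or used.
\<close>

definition psum :: "(nat \<Rightarrow> real \<Rightarrow> real) \<Rightarrow> nat \<Rightarrow> real \<Rightarrow> real" where
  "psum P j q = (\<Sum>i=1..j. P i q)"

text \<open>
  On an unbounded interval, piecewise linear means that every compact subinterval \<open>[q0, b]\<close>
  contains only finitely many break points. Since \<open>x\<close> and \<open>y\<close> below may themselves be break
  points, \<open>f\<close> is affine up to the end points of each piece. The slopes of the pieces are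
  required to lie in \<open>A\<close>; not every element of \<open>A\<close> has to occur as a slope.
\<close>

definition piecewise_linear_from :: "real \<Rightarrow> real set \<Rightarrow> (real \<Rightarrow> real) \<Rightarrow> bool" where
  "piecewise_linear_from q0 A f \<longleftrightarrow>
     (\<forall>b\<ge>q0. \<exists>B. finite B \<and>
        (\<forall>x y. q0 \<le> x \<and> x < y \<and> y \<le> b \<and> {x<..<y} \<inter> B = {} \<longrightarrow>
           (\<exists>s\<in>A. \<forall>t\<in>{x..y}. f t = f x + s * (t - x))))"

definition changes_slope :: "(real \<Rightarrow> real) \<Rightarrow> real \<Rightarrow> real \<Rightarrow> real \<Rightarrow> bool" where
  "changes_slope f s s' q \<longleftrightarrow>
     (f has_real_derivative s) (at_left q) \<and> (f has_real_derivative s') (at_right q)"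

definition n0_system :: "nat \<Rightarrow> real \<Rightarrow> (nat \<Rightarrow> real \<Rightarrow> real) \<Rightarrow> bool" where
  "n0_system n q0 P \<longleftrightarrow>
     (\<forall>j q. 1 \<le> j \<and> j < n \<and> q0 \<le> q \<longrightarrow> 0 \<le> P j q \<and> P j q \<le> P (j + 1) q) \<and>
     (\<forall>j q1 q2. 1 \<le> j \<and> j \<le> n \<and> q0 \<le> q1 \<and> q1 \<le> q2 \<longrightarrow> P j q1 \<le> P j q2) \<and>
     (\<forall>j. 1 \<le> j \<and> j \<le> n \<longrightarrow>
        continuous_on {q0..} (psum P j) \<and> piecewise_linear_from q0 {0, 1} (psum P j)) \<and>
     (\<forall>q\<ge>q0. psum P n q = q) \<and>
     (\<forall>j q. 1 \<le> j \<and> j < n \<and> q0 < q \<and> changes_slope (psum P j) 1 0 q \<longrightarrow> P (j + 1) q \<le> P j q)"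

text \<open>The convex body \<open>C_u(e^q)\<close>, with the parameter \<open>q\<close> on the logarithmic scale.\<close>

definition convex_body :: "real^'n \<Rightarrow> real \<Rightarrow> (real^'n) set" where
  "convex_body u q = {x. norm x \<le> 1 \<and> \<bar>x \<bullet> u\<bar> \<le> exp (- q)}"

definition integer_points :: "(real^'n) set" where
  "integer_points = {x. \<forall>i. x $ i \<in> \<int>}"

text \<open>For \<open>1 \<le> j \<le> CARD('n)\<close> the minimum exists, the integer points being discrete.\<close>

definition log_minimum :: "real^'n \<Rightarrow> nat \<Rightarrow> real \<Rightarrow> real" where
  "log_minimum u j q =
     (LEAST L. 0 \<le> L \<and>
        (\<exists>S. finite S \<and> card S = j \<and> independent S \<and>
             S \<subseteq> integer_points \<inter> (*\<^sub>R) (exp L) ` convex_body u q))"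

end

theory Submission
  imports Defs
begin

text \<open>
  One maintains a basis \<open>x\<close> of \<open>\<int>^n\<close> with a distinguished member \<open>x k\<close>; the remaining
  \<open>n - 1\<close> vectors are nearly orthogonal, in the sense of Gram--Schmidt, and span a hyperplane
  with unit normal \<open>u\<close>. When the component of \<open>P\<close> attached to \<open>x k\<close> stops rising at height
  \<open>a\<close> and that of \<open>x d\<close> starts, \<open>x k\<close> is replaced by
  \<open>x k + m x d + (smaller vectors)\<close> of length about \<open>exp a\<close>, and \<open>x d\<close> becomes the
  distinguished vector. Condition (S5) makes \<open>x d\<close> shorter than the new vector, which turns the
  hyperplane only by an amount comparable to \<open>exp (- q)\<close>; so the vectors
  keep having the trajectories prescribed by \<open>P\<close>, and upper bounds for all minima follow.
  As \<open>n\<close> independent integer points have determinant at least \<open>1\<close> in absolute value,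
  Hadamard's inequality turns them into lower bounds.
  An infinite system is treated by compactness of the sphere.
\<close>

subsection \<open>Spans of indexed families\<close>

text \<open>The replacement step recurs without limit, so no estimate may degrade with the number of
  steps. Lengths do not: each new vector takes its size from \<open>a\<close>, not from its
  predecessor. The turns of the normal decrease geometrically; \<open>radius\<close> bounds the sum
  of all turns still to come, and each bound is proved for every direction in that ball, hence
  survives later steps. Near orthogonality is the delicate point: every step disturbs the spans of
  shorter vectors, and the losses must remain summable. A step also needs sizes at least
  \<open>spacing n\<close> apart, whereas components of P may stay close or meet. Therefore P is
  followed only up to cells of length \<open>width n\<close>, and inside its cell a vector takes any
  free place. The final bound is cubic in n for three reasons: a gap linear in n beats the factor
  3^n of the coordinate estimates, a cell must offer n such gaps, and a lower bound for one minimum,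
  extracted from the sum of all, costs about n times the error of the upper bounds.\<close>

lemma span_image_iff_sum:
  fixes x :: "'i \<Rightarrow> 'a::real_vector"
  assumes "finite S"
  shows "v \<in> span (x ` S) \<longleftrightarrow> (\<exists>t. v = (\<Sum>i\<in>S. t i *\<^sub>R x i))"
  using assms
proof (induction S arbitrary: v)
  case empty
  show ?case by simp
next
  case (insert a S)
  have "v \<in> span (x ` insert a S) \<longleftrightarrow> (\<exists>k t. v - k *\<^sub>R x a = (\<Sum>i\<in>S. t i *\<^sub>R x i))"
    by (simp add: span_breakdown_eq insert.IH)
  also have "\<dots> \<longleftrightarrow> (\<exists>t. v = (\<Sum>i\<in>insert a S. t i *\<^sub>R x i))"
  proof safe
    fix k t assume v: "v - k *\<^sub>R x a = (\<Sum>i\<in>S. t i *\<^sub>R x i)"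
    have "(\<Sum>i\<in>insert a S. (t(a := k)) i *\<^sub>R x i) = k *\<^sub>R x a + (\<Sum>i\<in>S. t i *\<^sub>R x i)"
      using insert.hyps by (simp add: fun_upd_def) (rule sum.cong, auto)
    with v have "v = (\<Sum>i\<in>insert a S. (t(a := k)) i *\<^sub>R x i)"
      by (simp add: algebra_simps)
    then show "\<exists>t. v = (\<Sum>i\<in>insert a S. t i *\<^sub>R x i)" by blast
  next
    fix t assume "v = (\<Sum>i\<in>insert a S. t i *\<^sub>R x i)"
    then show "\<exists>k ta. (\<Sum>i\<in>insert a S. t i *\<^sub>R x i) - k *\<^sub>R x a = (\<Sum>i\<in>S. ta i *\<^sub>R x i)"
      using insert.hyps by (intro exI[of _ "t a"] exI[of _ t]) simp
  qed
  finally show ?case .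
qed

lemma span_orthogonal_decomp:
  fixes v :: "'a::euclidean_space"
  obtains p r where "p \<in> span S" "v = p + r" "\<And>w. w \<in> span S \<Longrightarrow> r \<bullet> w = 0"
  using orthogonal_subspace_decomp_exists[of S v] by (metis orthogonal_def inner_commute)

text \<open>Induction on \<open>card V\<close>, splitting off the index \<open>w\<close> with the
  largest \<open>A\<close>. All other vectors are below \<open>x w\<close>, so the hypothesis
  controls its coordinate; removing its term enlarges the norm of the sum by a factor of at most 1 +
  2 = 3.\<close>

lemma coordinate_bound:
  fixes x :: "'i \<Rightarrow> 'a::real_normed_vector" and A :: "'i \<Rightarrow> real"
  assumes "finite V" "inj_on A V"
    and "\<And>w g. w \<in> V \<Longrightarrow> g \<in> span (x ` {v\<in>V. A v < A w}) \<Longrightarrow> norm (x w) / 2 \<le> norm (x w + g)"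
    and "v \<in> V"
  shows "\<bar>t v\<bar> * norm (x v) \<le> 3 ^ card V * norm (\<Sum>i\<in>V. t i *\<^sub>R x i)"
  using assms
proof (induction "card V" arbitrary: V v)
  case 0
  then show ?case by simp
next
  case (Suc m)
  have "Max (A ` V) \<in> A ` V" using Suc.prems by (intro Max_in) auto
  then obtain w where w: "w \<in> V" "Max (A ` V) = A w" by auto
  have wmax: "A i < A w" if "i \<in> V" "i \<noteq> w" for i
  proof -
    have "A i \<le> A w" unfolding w(2)[symmetric] using that(1) Suc.prems(1) by (intro Max_ge) auto
    moreover have "A i \<noteq> A w" using that w(1) Suc.prems(2) by (auto dest: inj_onD)
    ultimately show ?thesis by simp
  qed
  define V0 where "V0 = V - {w}"
  have V0: "finite V0" "card V0 = m" "inj_on A V0"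
    using Suc.prems Suc.hyps(2) w by (auto simp: V0_def inj_on_diff)
  have low: "{v \<in> V. A v < A w} = V0" using wmax by (auto simp: V0_def)
  define X where "X = (\<Sum>i\<in>V. t i *\<^sub>R x i)"
  define Y where "Y = (\<Sum>i\<in>V0. t i *\<^sub>R x i)"
  have XY: "X = t w *\<^sub>R x w + Y"
    unfolding X_def Y_def V0_def using Suc.prems(1) w(1) by (rule sum.remove)
  have tw: "\<bar>t w\<bar> * norm (x w) \<le> 2 * norm X"
  proof (cases "t w = 0")
    case False
    have "(1 / t w) *\<^sub>R Y \<in> span (x ` V0)"
      unfolding Y_def by (intro span_scale span_sum) (auto intro: span_base)
    then have "norm (x w) / 2 \<le> norm (x w + (1 / t w) *\<^sub>R Y)"
      using Suc.prems(3)[OF w(1)] low by auto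
    also have "x w + (1 / t w) *\<^sub>R Y = (1 / t w) *\<^sub>R X"
      using False by (simp add: XY scaleR_add_right)
    finally show ?thesis using False by (simp add: field_simps)
  qed simp
  have card: "card V = Suc m" using Suc by simp
  show ?case
  proof (cases "v = w")
    case True
    have "2 * norm X \<le> 3 ^ card V * norm X"
      using card by (intro mult_right_mono) (auto intro: order_trans[of _ "3^1"])
    then show ?thesis using tw True X_def by simp
  next
    case False
    have "norm Y \<le> norm X + \<bar>t w\<bar> * norm (x w)"
      using XY norm_triangle_ineq4[of X "t w *\<^sub>R x w"] by simp
    then have Y: "norm Y \<le> 3 * norm X" using tw by simp
    have "\<bar>t v\<bar> * norm (x v) \<le> 3 ^ card V0 * norm Y"
      unfolding Y_def
    proof (rule Suc.hyps(1))
      fix u g assume u: "u \<in> V0" and g: "g \<in> span (x ` {v \<in> V0. A v < A u})"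
      have "span (x ` {v \<in> V0. A v < A u}) \<subseteq> span (x ` {v \<in> V. A v < A u})"
        by (intro span_mono image_mono) (auto simp: V0_def)
      then show "norm (x u) / 2 \<le> norm (x u + g)"
        using Suc.prems(3)[of u g] u g by (auto simp: V0_def)
    qed (use V0 False Suc.prems V0_def in auto)
    also have "\<dots> \<le> 3 ^ card V0 * (3 * norm X)"
      using Y by (intro mult_left_mono) auto
    finally show ?thesis using V0 card X_def by simp
  qed
qed

subsection \<open>Determinants and Gram--Schmidt\<close>

lemma det_rows_add_span:
  fixes x :: "'n::finite \<Rightarrow> real^'n"
  assumes "g \<in> span (x ` (UNIV - {i}))"
  shows "det (\<chi> j. (x(i := x i + g)) j) = det (\<chi> j. x j)"
proof -
  have "{row j (\<chi> j. x j) |j. j \<noteq> i} = x ` (UNIV - {i})"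
    by (auto simp: row_def vec_lambda_eta)
  with assms have "g \<in> vec.span {row j (\<chi> j. x j) |j. j \<noteq> i}"
    by (simp add: span_vec_eq)
  from det_row_span[OF this] show ?thesis
    by (simp add: row_def vec_lambda_eta fun_upd_def if_distrib cong: if_cong)
qed

lemma det_orthogonal_rows:
  fixes q :: "'n::finite \<Rightarrow> real^'n"
  assumes "\<And>i j. i \<noteq> j \<Longrightarrow> q i \<bullet> q j = 0"
  shows "\<bar>det (\<chi> j. q j)\<bar> = (\<Prod>i\<in>UNIV. norm (q i))"
proof -
  let ?Q = "\<chi> j. q j"
  have ent: "(?Q ** transpose ?Q) $ i $ j = q i \<bullet> q j" for i j
    by (simp add: matrix_matrix_mult_def transpose_def inner_vec_def)
  have "(det ?Q)\<^sup>2 = det (?Q ** transpose ?Q)"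
    by (simp add: det_mul power2_eq_square)
  also have "\<dots> = (\<Prod>i\<in>UNIV. q i \<bullet> q i)"
    by (subst det_diagonal) (auto simp: ent assms)
  also have "\<dots> = (\<Prod>i\<in>UNIV. norm (q i))\<^sup>2"
    by (simp add: prod_power_distrib power2_norm_eq_inner)
  finally have "\<bar>det ?Q\<bar> = \<bar>\<Prod>i\<in>UNIV. norm (q i)\<bar>"
    by (auto simp: power2_eq_iff)
  then show ?thesis by (simp add: prod_nonneg)
qed

text \<open>The order of orthogonalisation is given by an injective real function, since the index
  type carries none and \<open>unit_normal_bound\<close> has to rearrange it.\<close>

lemma Gram_Schmidt_det:
  fixes x :: "'n::finite \<Rightarrow> real^'n" and A :: "'n \<Rightarrow> real"
  assumes "inj A"
  obtains g where "\<And>w. g w \<in> span (x ` {v. A v < A w})"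
    and "\<And>w z. z \<in> span (x ` {v. A v < A w}) \<Longrightarrow> (x w + g w) \<bullet> z = 0"
    and "\<bar>det (\<chi> j. x j)\<bar> = (\<Prod>w\<in>UNIV. norm (x w + g w))"
proof -
  have "\<exists>g. g \<in> span (x ` {v. A v < A w}) \<and> (\<forall>z\<in>span (x ` {v. A v < A w}). (x w + g) \<bullet> z = 0)" for w
  proof -
    obtain p r where "p \<in> span (x ` {v. A v < A w})" "x w = p + r"
      "\<And>z. z \<in> span (x ` {v. A v < A w}) \<Longrightarrow> r \<bullet> z = 0"
      by (rule span_orthogonal_decomp[of "x ` {v. A v < A w}" "x w"]) blast
    then show ?thesis by (intro exI[of _ "- p"]) (auto simp: span_neg)
  qed
  then obtain g where g: "\<And>w. g w \<in> span (x ` {v. A v < A w})"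
    "\<And>w z. z \<in> span (x ` {v. A v < A w}) \<Longrightarrow> (x w + g w) \<bullet> z = 0"
    by metis
  define q where "q w = x w + g w" for w
  have qlow: "q v \<bullet> q w = 0" if "A v < A w" for v w
  proof -
    have "span (x ` {u. A u < A v}) \<subseteq> span (x ` {u. A u < A w})"
      using that by (intro span_mono image_mono) auto
    then have "q v \<in> span (x ` {u. A u < A w})"
      unfolding q_def using g(1)[of v] that by (intro span_add) (auto intro: span_base)
    then show ?thesis using g(2)[of "q v" w] by (simp add: q_def inner_commute)
  qed
  have orth: "q v \<bullet> q w = 0" if "v \<noteq> w" for v w
    using qlow[of v w] qlow[of w v] that assms
    by (metis inner_commute inj_eq linorder_neqE)
  \<comment> \<open>Rows are replaced from the largest \<open>A\<close> downwards. When the turn of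
    row \<open>w\<close> comes, all rows with smaller \<open>A\<close> are still the original ones,
    so adding \<open>g w\<close> is a row operation. The induction counts the rows already
    replaced.\<close>
  have "det (\<chi> j. if c \<le> A j then q j else x j) = det (\<chi> j. x j)" for c
  proof (induction "card {j. c \<le> A j}" arbitrary: c)
    case 0
    then have "\<not> c \<le> A j" for j by auto
    then show ?case by simp
  next
    case (Suc m)
    define T where "T = {j. c \<le> A j}"
    have "T \<noteq> {}" using Suc.hyps(2) unfolding T_def by (metis card.empty nat.distinct(1))
    then have "Min (A ` T) \<in> A ` T" by (intro Min_in) auto
    then obtain w where w: "w \<in> T" "Min (A ` T) = A w" by auto
    have wmin: "A w < A i" if "i \<in> T" "i \<noteq> w" for i
      proof -
      have "A w \<le> A i" unfolding w(2)[symmetric] using that(1) by (intro Min_le) auto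
      moreover have "A i \<noteq> A w" using that assms by (auto dest: injD)
      ultimately show ?thesis by simp
    qed
    \<comment> \<open>A threshold that cuts off \<open>w\<close> alone from
      \<open>T\<close>.\<close>
    define c' where "c' = (if T = {w} then A w + 1 else Min (A ` (T - {w})))"
    have c'1: "A w < c'"
    proof (cases "T = {w}")
      case False
      with w(1) have "A ` (T - {w}) \<noteq> {}" by auto
      then have "Min (A ` (T - {w})) \<in> A ` (T - {w})" by (intro Min_in) auto
      with False wmin show ?thesis by (auto simp: c'_def)
    qed (simp add: c'_def)
    have c'2: "c' \<le> A i" if "i \<in> T" "i \<noteq> w" for i
      using that by (auto simp: c'_def)
    have "j \<in> T" if "c' \<le> A j" for j
      using that c'1 w(1) by (simp add: T_def)
    then have T': "{j. c' \<le> A j} = T - {w}"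
      using c'1 c'2 by fastforce
    have m: "m = card {j. c' \<le> A j}"
      using Suc.hyps(2) w(1) T' by (simp add: T_def)
    define x' where "x' j = (if c' \<le> A j then q j else x j)" for j
    have "x ` {v. A v < A w} \<subseteq> x' ` (UNIV - {w})"
    proof
      fix z assume "z \<in> x ` {v. A v < A w}"
      then obtain v where v: "z = x v" "A v < A w" by auto
      then have "z = x' v" "v \<noteq> w" using c'1 by (auto simp: x'_def)
      then show "z \<in> x' ` (UNIV - {w})" by auto
    qed
    then have "g w \<in> span (x' ` (UNIV - {w}))"
      using g(1)[of w] span_mono by blast
    from det_rows_add_span[OF this]
    have "det (\<chi> j. (x'(w := x' w + g w)) j) = det (\<chi> j. x' j)" .
    also have "\<dots> = det (\<chi> j. x j)" using Suc.hyps(1)[OF m] by (simp add: x'_def)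
    also have "(x'(w := x' w + g w)) = (\<lambda>j. if c \<le> A j then q j else x j)"
    proof
      fix j
      have "c' \<le> A j \<longleftrightarrow> j \<in> T \<and> j \<noteq> w" using T' by auto
      then show "(x'(w := x' w + g w)) j = (if c \<le> A j then q j else x j)"
        using w(1) c'1 by (auto simp: x'_def q_def T_def)
    qed
    finally show ?case .
  qed
  from this[of "Min (range A)"] have "det (\<chi> j. q j) = det (\<chi> j. x j)"
    by simp
  with det_orthogonal_rows[of q, OF orth]
  have "\<bar>det (\<chi> j. x j)\<bar> = (\<Prod>w\<in>UNIV. norm (x w + g w))" by (simp add: q_def)
  with g that show thesis by blast
qed

text \<open>The determinant is the product of the Gram--Schmidt lengths, and each of these is a
  distance of the form bounded by \<open>b w\<close>.\<close>

lemma prod_le_abs_det: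
  fixes x :: "'n::finite \<Rightarrow> real^'n" and A :: "'n \<Rightarrow> real"
  assumes "inj A" and "\<And>w. 0 \<le> b w"
    and "\<And>w g. g \<in> span (x ` {v. A v < A w}) \<Longrightarrow> b w \<le> norm (x w + g)"
  shows "(\<Prod>w\<in>UNIV. b w) \<le> \<bar>det (\<chi> j. x j)\<bar>"
proof -
  obtain g where "\<And>w. g w \<in> span (x ` {v. A v < A w})"
    "\<bar>det (\<chi> j. x j)\<bar> = (\<Prod>w\<in>UNIV. norm (x w + g w))"
    by (rule Gram_Schmidt_det[OF assms(1), of x]) blast
  then show ?thesis using assms(2,3) by (auto intro!: prod_mono)
qed

text \<open>The narrow range is meant for the standard basis: sizes \<open>exp (A i)\<close> agree
  with length 1 up to a factor 2, while \<open>A\<close> still breaks all ties.\<close>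

lemma ex_inj_real:
  obtains A :: "'n::finite \<Rightarrow> real" where "inj A" "\<And>i. - (1/2) < A i" "\<And>i. A i \<le> 0"
proof -
  obtain f :: "'n \<Rightarrow> nat" where f: "inj f" and img: "f ` UNIV = {..<CARD('n)}"
    using ex_bij_betw_finite_nat[of "UNIV :: 'n set"]
    by (auto simp: bij_betw_def atLeast0LessThan)
  have lt: "f i < CARD('n)" for i using img by auto
  show thesis
  proof (rule that[of "\<lambda>i. - real (f i) / (2 * real CARD('n))"])
    show "inj (\<lambda>i. - real (f i) / (2 * real CARD('n)))"
      using f by (auto simp: inj_def)
    fix i
    show "- (1 / 2) < - real (f i) / (2 * real CARD('n))"
      using lt[of i] by (simp add: field_simps)
    show "- real (f i) / (2 * real CARD('n)) \<le> 0" by simp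
  qed
qed

lemma Hadamard_inequality:
  fixes x :: "'n::finite \<Rightarrow> real^'n"
  shows "\<bar>det (\<chi> j. x j)\<bar> \<le> (\<Prod>w\<in>UNIV. norm (x w))"
proof -
  obtain A :: "'n \<Rightarrow> real" where A: "inj A" by (rule ex_inj_real) blast
  obtain g where g: "\<And>w. g w \<in> span (x ` {v. A v < A w})"
    "\<And>w z. z \<in> span (x ` {v. A v < A w}) \<Longrightarrow> (x w + g w) \<bullet> z = 0"
    "\<bar>det (\<chi> j. x j)\<bar> = (\<Prod>w\<in>UNIV. norm (x w + g w))"
    by (rule Gram_Schmidt_det[OF A, of x]) blast
  have "norm (x w + g w) \<le> norm (x w)" for w
  proof -
    have "orthogonal (x w + g w) (- g w)"
      using g(2)[OF g(1)[of w]] by (simp add: orthogonal_def)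
    from norm_add_Pythagorean[OF this]
    have "(norm (x w))\<^sup>2 = (norm (x w + g w))\<^sup>2 + (norm (g w))\<^sup>2" by simp
    then have "(norm (x w + g w))\<^sup>2 \<le> (norm (x w))\<^sup>2" by (metis le_add_same_cancel1 zero_le_power2)
    then show ?thesis by (rule power2_le_imp_le) simp
  qed
  then show ?thesis unfolding g(3) by (intro prod_mono) auto
qed

subsection \<open>Integer points\<close>

lemma integer_points_add: "x \<in> integer_points \<Longrightarrow> y \<in> integer_points \<Longrightarrow> x + y \<in> integer_points"
  by (simp add: integer_points_def)

lemma integer_points_scale: "x \<in> integer_points \<Longrightarrow> of_int c *\<^sub>R x \<in> integer_points"
  by (simp add: integer_points_def)

lemma integer_points_scale_nat: "x \<in> integer_points \<Longrightarrow> real m *\<^sub>R x \<in> integer_points"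
  using integer_points_scale[of x "int m"] by simp

lemma integer_points_sum: "(\<And>i. i \<in> S \<Longrightarrow> x i \<in> integer_points) \<Longrightarrow> (\<Sum>i\<in>S. x i) \<in> integer_points"
  by (induction S rule: infinite_finite_induct) (auto simp: integer_points_def)

lemma integer_points_axis: "axis i 1 \<in> integer_points"
  by (simp add: integer_points_def axis_def)

subsection \<open>Reduced bases\<close>

text \<open>Made for \<open>exp_spacing\<close>: 7/5 = 23/20 + 1/4, where 23/20 pays for 3^n and 1/4
  for the factor n; the summand 6 absorbs 64 * 4 = 256.\<close>

definition spacing :: "nat \<Rightarrow> real" where
  "spacing n = 7 / 5 * real n + 6"

lemma spacing_pos: "0 < spacing n" by (simp add: spacing_def)

lemma exp_spacing:
  assumes "1 \<le> n"
  shows "64 * real n * 3 ^ n * exp (- spacing n) \<le> 1"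
proof -
  have e2: "3 \<le> exp (23 / 20 :: real)"
    using exp_ge_one_plus_x_over_n_power_n[of 30 "23 / 20 :: real"] by (simp add: power_divide)
  have "(3::real) ^ n \<le> exp (23 / 20) ^ n" using e2 by (intro power_mono) auto
  also have "\<dots> = exp (23 / 20 * real n)" by (simp add: exp_of_nat2_mult[symmetric] mult.commute)
  finally have a: "(3::real) ^ n \<le> exp (23 / 20 * real n)" .
  have b: "real n \<le> 4 * exp (real n / 4)" using exp_ge_add_one_self[of "real n / 4"] by linarith
  have c: "256 \<le> exp (6::real)"
    using exp_ge_one_plus_x_over_n_power_n[of 60 "6::real"] by (simp add: power_divide)
  have "64 * real n * 3 ^ n \<le> 64 * (4 * exp (real n / 4)) * exp (23 / 20 * real n)"
    using a b by (intro mult_mono) auto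
  also have "\<dots> \<le> exp 6 * exp (real n / 4) * exp (23 / 20 * real n)"
    using c by (intro mult_right_mono) auto
  also have "\<dots> = exp (spacing n)" by (simp add: spacing_def flip: exp_add)
  finally show ?thesis by (simp add: exp_minus field_simps)
qed

definition below :: "'n \<Rightarrow> ('n \<Rightarrow> real) \<Rightarrow> 'n \<Rightarrow> 'n set" where
  "below k A w = {v. v \<noteq> k \<and> A v < A w}"

text \<open>The unit in which losses of near orthogonality are counted. Its form makes
  \<open>slack n / (4 * 3 ^ n) * exp a\<close> equal to \<open>2 * exp (a - spacing n)\<close>, the
  length bound one spacing below \<open>a\<close>; all n + 1 units together amount to at most
  1/4.\<close>

definition slack :: "nat \<Rightarrow> real" where
  "slack n = 8 * 3 ^ n * exp (- spacing n)"

lemma slack_pos: "0 < slack n" by (simp add: slack_def)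

lemma slack_le:
  assumes "1 \<le> n"
  shows "real n * slack n \<le> 1 / 8"
  using exp_spacing[OF assms] by (simp add: slack_def)

text \<open>
  The vector \<open>x k\<close> is the one about to be replaced; \<open>A\<close> prescribes logarithmic sizes. The
  remaining vectors keep a definite proportion of their length modulo the smaller ones. This
  proportion deteriorates when the span of the smaller ones rotates, at a rate governed by
  \<open>\<rho>\<close>, the relative distance of \<open>x k\<close> to that span. Since \<open>\<rho>\<close> at least halves
  at each such step, and the number of smaller vectors drops each time \<open>\<rho>\<close> is reset, the
  total loss stays bounded.
\<close>

definition reduced_basis :: "('n::finite \<Rightarrow> real^'n) \<Rightarrow> 'n \<Rightarrow> ('n \<Rightarrow> real) \<Rightarrow> bool" where
  "reduced_basis x k A \<longleftrightarrow> inj A \<and> (\<forall>i. x i \<in> integer_points) \<and> det (\<chi> i. x i) = 1 \<and>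
     (\<forall>i. exp (A i) / 2 \<le> norm (x i) \<and> norm (x i) \<le> 2 * exp (A i)) \<and>
     (\<forall>w. w \<noteq> k \<longrightarrow> (\<exists>\<rho>. 0 \<le> \<rho> \<and> \<rho> \<le> 1 \<and>
        (\<forall>g\<in>span (x ` below k A w).
           (1 / 2 + slack CARD('n) * (real (card (below k A w)) + \<rho>)) * norm (x w) \<le> norm (x w + g)) \<and>
        (A k < A w \<longrightarrow> (\<exists>g\<in>span (x ` below k A w). norm (x k - g) \<le> \<rho> * norm (x k)))))"

definition unit_normal :: "real^'n \<Rightarrow> ('n::finite \<Rightarrow> real^'n) \<Rightarrow> 'n \<Rightarrow> bool" where
  "unit_normal u x k \<longleftrightarrow> norm u = 1 \<and> (\<forall>v. v \<noteq> k \<longrightarrow> u \<bullet> x v = 0)"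

lemma reduced_half:
  fixes x :: "'n::finite \<Rightarrow> real^'n"
  assumes "reduced_basis x k A" "w \<noteq> k" "g \<in> span (x ` below k A w)"
  shows "norm (x w) / 2 \<le> norm (x w + g)"
proof -
  from assms obtain \<rho> where "0 \<le> \<rho>"
    and *: "(1 / 2 + slack CARD('n) * (real (card (below k A w)) + \<rho>)) * norm (x w) \<le> norm (x w + g)"
    unfolding reduced_basis_def by blast
  then have "1 / 2 * norm (x w) \<le> (1 / 2 + slack CARD('n) * (real (card (below k A w)) + \<rho>)) * norm (x w)"
    using slack_pos[of "CARD('n)"] by (intro mult_right_mono) auto
  with * show ?thesis by simp
qed

lemma reduced_nonzero: "reduced_basis x k A \<Longrightarrow> 0 < norm (x i)"
  unfolding reduced_basis_def by (metis exp_gt_zero half_gt_zero order_less_le_trans)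

lemma reduced_coordinate:
  fixes x :: "'n::finite \<Rightarrow> real^'n"
  assumes red: "reduced_basis x k A" and V: "k \<notin> V" "v \<in> V"
  shows "\<bar>t v\<bar> * norm (x v) \<le> 3 ^ CARD('n) * norm (\<Sum>i\<in>V. t i *\<^sub>R x i)"
proof -
  have "\<bar>t v\<bar> * norm (x v) \<le> 3 ^ card V * norm (\<Sum>i\<in>V. t i *\<^sub>R x i)"
  proof (rule coordinate_bound)
    show "inj_on A V" using red by (auto simp: reduced_basis_def intro: inj_on_subset)
    fix w g assume w: "w \<in> V" and g: "g \<in> span (x ` {v \<in> V. A v < A w})"
    have "span (x ` {v \<in> V. A v < A w}) \<subseteq> span (x ` below k A w)"
      using V by (intro span_mono image_mono) (auto simp: below_def)
    with g w V show "norm (x w) / 2 \<le> norm (x w + g)"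
      by (intro reduced_half[OF red]) auto
  qed (use V in auto)
  also have "\<dots> \<le> 3 ^ CARD('n) * norm (\<Sum>i\<in>V. t i *\<^sub>R x i)"
    by (intro mult_right_mono power_increasing card_mono) auto
  finally show ?thesis .
qed

text \<open>\<open>reduced_half\<close> compares \<open>x v\<close> only with vectors of smaller
  \<open>A\<close>. Comparison with larger ones as well costs the factor
  \<open>3 ^ CARD('n)\<close>.\<close>

lemma reduced_dist:
  fixes x :: "'n::finite \<Rightarrow> real^'n"
  assumes red: "reduced_basis x k A" and V: "k \<notin> V" "v \<in> V" and g: "g \<in> span (x ` (V - {v}))"
  shows "\<bar>c\<bar> * norm (x v) \<le> 3 ^ CARD('n) * norm (c *\<^sub>R x v + g)"
proof -
  obtain t where t: "g = (\<Sum>i\<in>V - {v}. t i *\<^sub>R x i)"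
    using g by (subst (asm) span_image_iff_sum) auto
  have "(\<Sum>i\<in>V. (t(v := c)) i *\<^sub>R x i) = c *\<^sub>R x v + (\<Sum>i\<in>V - {v}. (t(v := c)) i *\<^sub>R x i)"
    using V by (subst sum.remove[of V v]) auto
  also have "(\<Sum>i\<in>V - {v}. (t(v := c)) i *\<^sub>R x i) = g"
    unfolding t by (rule sum.cong) auto
  finally show ?thesis using reduced_coordinate[OF red V, of "t(v := c)"] by simp
qed

text \<open>Order the vectors with \<open>k\<close> last, by raising \<open>A k\<close> to
  \<open>M\<close>. The last Gram--Schmidt factor of the determinant 1 is at least
  \<open>\<bar>u \<bullet> x k\<bar>\<close>, because \<open>u\<close> is orthogonal to the other
  vectors; every other factor is at least \<open>exp (A w) / 4\<close>.\<close>

lemma unit_normal_bound: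
  fixes x :: "'n::finite \<Rightarrow> real^'n"
  assumes red: "reduced_basis x k A" and u: "unit_normal u x k"
  shows "\<bar>u \<bullet> x k\<bar> \<le> 4 ^ (CARD('n) - 1) * exp (- (\<Sum>v\<in>UNIV - {k}. A v))"
proof -
  define M where "M = Max (range A) + 1"
  define b where "b w = (if w = k then \<bar>u \<bullet> x k\<bar> else exp (A w) / 4)" for w
  have M: "A v < M" for v
    using Max_ge[of "range A" "A v"] unfolding M_def by (smt (verit) finite finite_imageI rangeI)
  have injA: "inj A" using red by (simp add: reduced_basis_def)
  have "inj (A(k := M))"
    using injA M by (auto simp: inj_def less_le)
  then have "(\<Prod>w\<in>UNIV. b w) \<le> \<bar>det (\<chi> j. x j)\<bar>"
  proof (rule prod_le_abs_det)
    show "0 \<le> b w" for w by (simp add: b_def)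
    fix w g assume g: "g \<in> span (x ` {v. (A(k := M)) v < (A(k := M)) w})"
    show "b w \<le> norm (x w + g)"
    proof (cases "w = k")
      case True
      have "{v. (A(k := M)) v < (A(k := M)) w} \<subseteq> UNIV - {k}" using True by auto
      then have "g \<in> span (x ` (UNIV - {k}))" using g span_mono image_mono by (metis subsetD)
      then obtain t where "g = (\<Sum>i\<in>UNIV - {k}. t i *\<^sub>R x i)"
        by (subst (asm) span_image_iff_sum) auto
      then have "u \<bullet> g = 0"
        using u by (auto simp: inner_sum_right unit_normal_def)
      then have "\<bar>u \<bullet> x k\<bar> = \<bar>u \<bullet> (x k + g)\<bar>" by (simp add: inner_add_right)
      also have "\<dots> \<le> norm u * norm (x k + g)" by (rule Cauchy_Schwarz_ineq2)
      finally show ?thesis using u True by (simp add: b_def unit_normal_def)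
    next
      case False
      have "{v. (A(k := M)) v < (A(k := M)) w} = below k A w"
        using False M[of w] by (auto simp: below_def)
      then have "norm (x w) / 2 \<le> norm (x w + g)" using reduced_half[OF red False] g by simp
      moreover have "exp (A w) / 2 \<le> norm (x w)" using red by (simp add: reduced_basis_def)
      ultimately show ?thesis using False by (simp add: b_def)
    qed
  qed
  also have "\<dots> = 1" using red by (simp add: reduced_basis_def)
  also have "(\<Prod>w\<in>UNIV. b w) = \<bar>u \<bullet> x k\<bar> * (\<Prod>w\<in>UNIV - {k}. exp (A w) / 4)"
    by (subst prod.remove[of _ k]) (auto simp: b_def)
  also have "(\<Prod>w\<in>UNIV - {k}. exp (A w) / 4) = exp (\<Sum>v\<in>UNIV - {k}. A v) / 4 ^ (CARD('n) - 1)"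
    by (simp add: prod_dividef exp_sum card_Diff_singleton)
  finally show ?thesis by (simp add: exp_minus field_simps)
qed

lemma norm_le_add_orthogonal:
  fixes e z :: "'a::real_inner"
  assumes "e \<bullet> z = 0"
  shows "norm e \<le> norm (e + z)"
proof -
  have "(norm (e + z))\<^sup>2 = (norm e)\<^sup>2 + (norm z)\<^sup>2"
    using assms by (intro norm_add_Pythagorean) (simp add: orthogonal_def)
  then have "(norm e)\<^sup>2 \<le> (norm (e + z))\<^sup>2" by simp
  then show ?thesis by (rule power2_le_imp_le) simp
qed

subsection \<open>Replacing one vector of a reduced basis\<close>

text \<open>The gap around \<open>a\<close> makes \<open>x k\<close>, \<open>x d\<close> and the
  other vectors below \<open>a\<close> negligible against the new vector of length about
  \<open>exp a\<close>.\<close>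

definition admissible :: "'n::finite \<Rightarrow> 'n \<Rightarrow> ('n \<Rightarrow> real) \<Rightarrow> real \<Rightarrow> bool" where
  "admissible k d A a \<longleftrightarrow> d \<noteq> k \<and> A k + spacing CARD('n) \<le> a \<and> A d + spacing CARD('n) \<le> a \<and>
     (\<forall>v. v \<noteq> k \<longrightarrow> A v + spacing CARD('n) \<le> a \<or> a + spacing CARD('n) \<le> A v)"

text \<open>The proportions satisfy 3/4 * 9/8 < 15/16, so the new vector keeps three quarters of its
  length modulo the smaller ones. This covers 1/2 plus the largest loss that \<open>slack\<close>
  can account for.\<close>

definition step_vector :: "('n::finite \<Rightarrow> real^'n) \<Rightarrow> 'n \<Rightarrow> 'n \<Rightarrow> ('n \<Rightarrow> real) \<Rightarrow> real \<Rightarrow> nat \<Rightarrow> real^'n \<Rightarrow> bool" where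
  "step_vector x k d A a m g \<longleftrightarrow> g \<in> span (x ` {v. v \<noteq> k \<and> v \<noteq> d \<and> A v < a}) \<and>
     x k + real m *\<^sub>R x d + g \<in> integer_points \<and>
     exp a \<le> real m * norm (x d) \<and>
     norm (x k + real m *\<^sub>R x d + g) \<le> 9 / 8 * exp a \<and>
     (\<forall>h\<in>span (x ` {v. v \<noteq> k \<and> v \<noteq> d \<and> A v < a}).
        15 / 16 * exp a \<le> norm (x k + real m *\<^sub>R x d + g + h))"

lemma small_bound:
  fixes x :: "'n::finite \<Rightarrow> real^'n"
  assumes "reduced_basis x k A" "A v + spacing CARD('n) \<le> a"
  shows "norm (x v) \<le> slack CARD('n) / (4 * 3 ^ CARD('n)) * exp a"
proof -
  have "norm (x v) \<le> 2 * exp (A v)" using assms by (simp add: reduced_basis_def)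
  also have "\<dots> \<le> 2 * exp (a - spacing CARD('n))" using assms(2) by simp
  also have "\<dots> = slack CARD('n) / (4 * 3 ^ CARD('n)) * exp a"
    by (simp add: slack_def exp_diff exp_minus field_simps)
  finally show ?thesis .
qed

lemma slack_card: "real CARD('n::finite) * slack CARD('n) \<le> 1 / 8"
  by (rule slack_le) (simp add: Suc_leI)

lemma slack_card': "slack CARD('n::finite) \<le> 1 / 8"
proof -
  have "1 * slack CARD('n) \<le> real CARD('n) * slack CARD('n)"
    using slack_pos[of "CARD('n)"] by (intro mult_right_mono) (auto simp: Suc_leI)
  then show ?thesis using slack_card[where 'n='n] by simp
qed

text \<open>Split along the span of the vectors indexed by \<open>S\<close>. Orthogonally to it, the
  multiple \<open>m\<close> of the residue \<open>rd\<close> is the first to reach length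
  \<open>exp a\<close>, so it overshoots by at most \<open>norm rd\<close>. Inside it, rounding the
  coordinates to integers leaves at most half of each of the short vectors.\<close>

lemma ex_step_vector:
  fixes x :: "'n::finite \<Rightarrow> real^'n"
  assumes red: "reduced_basis x k A" and adm: "admissible k d A a"
  obtains m g where "step_vector x k d A a m g"
proof -
  define S where "S = {v. v \<noteq> k \<and> v \<noteq> d \<and> A v < a}"
  define \<theta> where "\<theta> = slack CARD('n) / (4 * 3 ^ CARD('n)) * exp a"
  have adm': "d \<noteq> k" "A k + spacing CARD('n) \<le> a" "A d + spacing CARD('n) \<le> a"
    "\<And>v. v \<noteq> k \<Longrightarrow> A v + spacing CARD('n) \<le> a \<or> a + spacing CARD('n) \<le> A v"
    using adm by (auto simp: admissible_def)
  have \<theta>0: "0 < \<theta>" using slack_pos by (simp add: \<theta>_def)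
  have three: "(3::real) \<le> 3 ^ CARD('n)" using power_increasing[of 1 "CARD('n)" "3::real"] by (simp add: Suc_leI)
  have "slack CARD('n) * real CARD('n) / (4 * 3 ^ CARD('n)) \<le> (1 / 8) / (4 * 3)"
    using slack_card[where 'n='n] three by (intro frac_le) (auto simp: mult.commute)
  then have n\<theta>: "real CARD('n) * \<theta> \<le> exp a / 96"
    using mult_right_mono[of "slack CARD('n) * real CARD('n) / (4 * 3 ^ CARD('n))" "1/96" "exp a"]
    by (simp add: \<theta>_def mult_ac)
  have "1 * \<theta> \<le> real CARD('n) * \<theta>" using \<theta>0 by (intro mult_right_mono) (auto simp: Suc_leI)
  with n\<theta> have \<theta>1: "\<theta> \<le> exp a / 96" by simp
  have xk: "norm (x k) \<le> \<theta>" and xd: "norm (x d) \<le> \<theta>"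
    using small_bound[OF red] adm'(2,3) by (auto simp: \<theta>_def)
  have xS: "norm (x v) \<le> \<theta>" if "v \<in> S" for v
  proof -
    have "A v + spacing CARD('n) \<le> a"
      using that adm'(4)[of v] spacing_pos[of "CARD('n)"] by (auto simp: S_def)
    then show ?thesis using small_bound[OF red] by (simp add: \<theta>_def)
  qed
  obtain pd rd where pd: "pd \<in> span (x ` S)" "x d = pd + rd" "\<And>w. w \<in> span (x ` S) \<Longrightarrow> rd \<bullet> w = 0"
    by (rule span_orthogonal_decomp[of "x ` S" "x d"]) blast
  obtain pk rk where pk: "pk \<in> span (x ` S)" "x k = pk + rk" "\<And>w. w \<in> span (x ` S) \<Longrightarrow> rk \<bullet> w = 0"
    by (rule span_orthogonal_decomp[of "x ` S" "x k"]) blast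
  have "1 * norm (x d) \<le> 3 ^ CARD('n) * norm (1 *\<^sub>R x d + (- pd))"
    using reduced_dist[OF red, of "insert d S" d "- pd" 1] pd(1) adm'(1)
    by (simp add: S_def span_neg)
  moreover have "1 *\<^sub>R x d + (- pd) = rd" using pd(2) by simp
  ultimately have rd0: "0 < norm rd" using reduced_nonzero[OF red, of d]
    by (metis less_le_not_le mult_1 mult_zero_right norm_ge_zero norm_zero order_le_less)
  have rdle: "norm rd \<le> norm (x d)"
    using norm_le_add_orthogonal[OF pd(3)[OF pd(1)]] pd(2) by (simp add: add.commute)
  have rkle: "norm rk \<le> norm (x k)"
    using norm_le_add_orthogonal[OF pk(3)[OF pk(1)]] pk(2) by (simp add: add.commute)
  define m where "m = nat \<lceil>exp a / norm rd\<rceil>"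
  have m: "real m = of_int \<lceil>exp a / norm rd\<rceil>"
    using rd0 by (simp add: m_def)
  have m1: "exp a \<le> real m * norm rd"
    using rd0 mult_right_mono[OF le_of_int_ceiling[of "exp a / norm rd"], of "norm rd"]
    unfolding m by simp
  have "real m \<le> exp a / norm rd + 1" unfolding m by (rule of_int_ceiling_le_add_one)
  then have m2: "real m * norm rd \<le> exp a + norm rd" using rd0 by (simp add: field_simps)
  have "pk + real m *\<^sub>R pd \<in> span (x ` S)" using pk(1) pd(1) by (intro span_add span_scale)
  then obtain t where t: "pk + real m *\<^sub>R pd = (\<Sum>i\<in>S. t i *\<^sub>R x i)"
    by (subst (asm) span_image_iff_sum) auto
  define c where "c i = - round (t i)" for i
  have c: "\<bar>t i + of_int (c i)\<bar> \<le> 1 / 2" for i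
    using of_int_round_abs_le[of "t i"] by (simp add: c_def abs_minus_commute)
  define g where "g = (\<Sum>i\<in>S. of_int (c i) *\<^sub>R x i)"
  define e where "e = rk + real m *\<^sub>R rd"
  define z where "z = (\<Sum>i\<in>S. (t i + of_int (c i)) *\<^sub>R x i)"
  define y where "y = x k + real m *\<^sub>R x d + g"
  have y: "y = e + z"
  proof -
    have "y = e + ((pk + real m *\<^sub>R pd) + g)"
      by (simp add: y_def e_def pd(2) pk(2) scaleR_add_right)
    also have "(pk + real m *\<^sub>R pd) + g = z"
      unfolding t g_def z_def by (simp add: sum.distrib scaleR_add_left)
    finally show ?thesis .
  qed
  have zS: "z \<in> span (x ` S)" unfolding z_def by (intro span_sum span_scale span_base) auto
  have gS: "g \<in> span (x ` S)" unfolding g_def by (intro span_sum span_scale span_base) auto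
  have "norm z \<le> (\<Sum>i\<in>S. \<bar>t i + of_int (c i)\<bar> * norm (x i))"
    unfolding z_def by (rule order_trans[OF norm_sum]) simp
  also have "\<dots> \<le> (\<Sum>i\<in>S. 1 / 2 * \<theta>)"
    using c xS by (intro sum_mono mult_mono) auto
  also have "\<dots> \<le> real CARD('n) * (1 / 2 * \<theta>)"
    using \<theta>0 by (simp add: card_mono)
  finally have z: "norm z \<le> exp a / 192" using n\<theta> by simp
  have e1: "norm e \<le> exp a + 2 * \<theta>"
    using norm_triangle_ineq[of rk "real m *\<^sub>R rd"] rkle rdle xk xd m2 by (simp add: e_def)
  have e2: "exp a - \<theta> \<le> norm e"
    using norm_diff_ineq[of "real m *\<^sub>R rd" rk] rkle xk m1 by (simp add: e_def add.commute)
  have "y \<in> integer_points"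
    unfolding y_def g_def using red
    by (intro integer_points_add integer_points_sum integer_points_scale integer_points_scale_nat)
      (auto simp: reduced_basis_def)
  moreover have "exp a \<le> real m * norm (x d)"
    using m1 mult_left_mono[OF rdle, of "real m"] by simp
  moreover have "norm y \<le> 9 / 8 * exp a"
    using norm_triangle_ineq[of e z] e1 z \<theta>1 exp_gt_zero[of a] unfolding y by linarith
  moreover have "15 / 16 * exp a \<le> norm (y + h)" if h: "h \<in> span (x ` S)" for h
  proof -
    have "z + h \<in> span (x ` S)" using zS h by (rule span_add)
    then have "e \<bullet> (z + h) = 0" using pd(3) pk(3) by (simp add: e_def inner_add_left)
    from norm_le_add_orthogonal[OF this] show ?thesis using e2 \<theta>1 exp_gt_zero[of a] unfolding y add.assoc by linarith
  qed
  ultimately have "step_vector x k d A a m g"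
    using gS unfolding step_vector_def S_def y_def by blast
  then show thesis by (rule that)
qed

text \<open>For the new vector itself, \<open>step_vector\<close> gives the bound. For
  \<open>A w < a\<close>, the set below \<open>w\<close> can only lose \<open>d\<close>. The
  critical case is \<open>a < A w\<close>, where the new vector takes the place of
  \<open>x d\<close> below \<open>w\<close>: the span turns by an amount proportional to \<rho>, and
  halving \<rho> pays for it.\<close>

lemma reduced_step:
  fixes x :: "'n::finite \<Rightarrow> real^'n"
  assumes red: "reduced_basis x k A" and adm: "admissible k d A a" and st: "step_vector x k d A a m g"
  shows "reduced_basis (x(k := x k + real m *\<^sub>R x d + g)) d (A(k := a))"
proof -
  define y where "y = x k + real m *\<^sub>R x d + g"
  define S where "S = {v. v \<noteq> k \<and> v \<noteq> d \<and> A v < a}"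
  define \<eta> where "\<eta> = slack CARD('n)"
  define \<theta> where "\<theta> = \<eta> / (4 * 3 ^ CARD('n)) * exp a"
  define K where "K = (3::real) ^ CARD('n)"
  have K: "1 \<le> K" by (simp add: K_def)
  have adm': "d \<noteq> k" "A k + spacing CARD('n) \<le> a" "A d + spacing CARD('n) \<le> a"
    "\<And>v. v \<noteq> k \<Longrightarrow> A v + spacing CARD('n) \<le> a \<or> a + spacing CARD('n) \<le> A v"
    using adm by (auto simp: admissible_def)
  have st': "g \<in> span (x ` S)" "y \<in> integer_points" "exp a \<le> real m * norm (x d)"
     "norm y \<le> 9 / 8 * exp a" "\<And>h. h \<in> span (x ` S) \<Longrightarrow> 15 / 16 * exp a \<le> norm (y + h)"
    using st unfolding step_vector_def S_def y_def by blast+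
  have injA: "inj A" using red by (simp add: reduced_basis_def)
  have \<eta>0: "0 < \<eta>" using slack_pos by (simp add: \<eta>_def)
  have n\<eta>: "real CARD('n) * \<eta> \<le> 1 / 8" "\<eta> \<le> 1 / 8"
    using slack_card[where 'n='n] slack_card'[where 'n='n] by (simp_all add: \<eta>_def)
  have \<theta>0: "0 < \<theta>" using \<eta>0 by (simp add: \<theta>_def)
  have K\<theta>: "K * \<theta> = \<eta> / 4 * exp a" by (simp add: \<theta>_def K_def)
  have "\<eta> / 4 * exp a \<le> (1 / 8) / 4 * exp a" using n\<eta> by (intro mult_right_mono) auto
  then have K\<theta>': "K * \<theta> \<le> exp a / 32" unfolding K\<theta> by simp
  have "1 * \<theta> \<le> K * \<theta>" using K \<theta>0 by (intro mult_right_mono) auto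
  with K\<theta>' have \<theta>1: "\<theta> \<le> exp a / 32" by simp
  have xk: "norm (x k) \<le> \<theta>"
    using small_bound[OF red adm'(2)] by (simp add: \<theta>_def \<eta>_def)
  have sp: "0 < spacing CARD('n)" by (rule spacing_pos)
  have Aa: "A v \<noteq> a" for v using adm'(2) adm'(4)[of v] sp by (cases "v = k") auto
  have "inj (A(k := a))" using injA Aa by (auto simp: inj_def)
  moreover have "\<forall>i. (x(k := y)) i \<in> integer_points"
    using red st'(2) by (simp add: reduced_basis_def)
  moreover have "det (\<chi> i. (x(k := y)) i) = 1"
  proof -
    have "span (x ` S) \<subseteq> span (x ` (UNIV - {k}))"
      by (intro span_mono image_mono) (auto simp: S_def)
    then have "g \<in> span (x ` (UNIV - {k}))" using st'(1) by blast
    moreover have "x d \<in> span (x ` (UNIV - {k}))" using adm'(1) by (intro span_base) auto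
    ultimately have "real m *\<^sub>R x d + g \<in> span (x ` (UNIV - {k}))"
      by (intro span_add span_scale)
    from det_rows_add_span[OF this] show ?thesis
      using red by (simp add: reduced_basis_def y_def add.assoc)
  qed
  moreover have "\<forall>i. exp ((A(k := a)) i) / 2 \<le> norm ((x(k := y)) i) \<and>
      norm ((x(k := y)) i) \<le> 2 * exp ((A(k := a)) i)"
    using red st'(4) st'(5)[of 0] by (auto simp: reduced_basis_def span_zero)
  moreover have "\<exists>\<rho>. 0 \<le> \<rho> \<and> \<rho> \<le> 1 \<and>
        (\<forall>g\<in>span ((x(k := y)) ` below d (A(k := a)) w).
           (1 / 2 + \<eta> * (real (card (below d (A(k := a)) w)) + \<rho>)) * norm ((x(k := y)) w)
             \<le> norm ((x(k := y)) w + g)) \<and>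
        ((A(k := a)) d < (A(k := a)) w \<longrightarrow>
          (\<exists>g\<in>span ((x(k := y)) ` below d (A(k := a)) w).
             norm ((x(k := y)) d - g) \<le> \<rho> * norm ((x(k := y)) d)))"
    if wd: "w \<noteq> d" for w
  proof (cases "w = k")
    case True
    have B: "below d (A(k := a)) w = S" using True adm'(1) sp by (auto simp: below_def S_def)
    have im: "x(k := y) ` S = x ` S" by (rule image_cong) (auto simp: S_def)
    have "\<eta> * (real (card S) + 1) \<le> \<eta> * (real CARD('n) + 1)"
      using \<eta>0 by (intro mult_left_mono) (auto simp: card_mono)
    also have "\<dots> \<le> 1 / 4" using n\<eta> by (simp add: algebra_simps)
    finally have c: "1 / 2 + \<eta> * (real (card S) + 1) \<le> 3 / 4" by simp
    have "(1 / 2 + \<eta> * (real (card S) + 1)) * norm y \<le> norm (y + h)" if "h \<in> span (x ` S)" for h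
    proof -
      have "(1 / 2 + \<eta> * (real (card S) + 1)) * norm y \<le> 3 / 4 * (9 / 8 * exp a)"
        using c st'(4) by (intro mult_mono) auto
      also have "\<dots> \<le> 15 / 16 * exp a" by simp
      also have "\<dots> \<le> norm (y + h)" by (rule st'(5)[OF that])
      finally show ?thesis .
    qed
    \<comment> \<open>With \<rho> = 1 the distance condition holds trivially, by comparison with the
      zero vector.\<close>
    then show ?thesis using True B im adm'(1)
      by (intro exI[of _ 1]) (auto intro!: bexI[of _ 0] simp: span_zero)
  next
    case wk: False
    obtain \<rho> where \<rho>: "0 \<le> \<rho>" "\<rho> \<le> 1"
      and bw: "\<And>g. g \<in> span (x ` below k A w) \<Longrightarrow>
           (1 / 2 + \<eta> * (real (card (below k A w)) + \<rho>)) * norm (x w) \<le> norm (x w + g)"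
      and xkg: "A k < A w \<Longrightarrow> \<exists>g\<in>span (x ` below k A w). norm (x k - g) \<le> \<rho> * norm (x k)"
      using red wk unfolding reduced_basis_def \<eta>_def by blast
    show ?thesis
    proof (cases "A w < a")
      case True
      define B where "B = below k A w"
      have B': "below d (A(k := a)) w = B - {d}" using True wk by (auto simp: below_def B_def)
      have im: "x(k := y) ` (B - {d}) = x ` (B - {d})" by (rule image_cong) (auto simp: B_def below_def)
      have sub: "span (x ` (B - {d})) \<subseteq> span (x ` B)" by (intro span_mono image_mono) auto
      show ?thesis
      proof (cases "A d < A w")
        \<comment> \<open>There is one vector fewer below \<open>w\<close>; the unit of slack thus
          freed allows \<rho> to be reset to 1.\<close>
        case dw: True
        then have dB: "d \<in> B" using adm'(1) by (auto simp: B_def below_def)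
        then have card: "real (card (B - {d})) + 1 = real (card B)"
          by (metis Suc_eq_plus1 card.remove finite of_nat_Suc add.commute)
        have "(1 / 2 + \<eta> * (real (card (B - {d})) + 1)) * norm (x w) \<le> norm (x w + h)"
          if "h \<in> span (x ` (B - {d}))" for h
        proof -
          have "(1 / 2 + \<eta> * (real (card (B - {d})) + 1)) * norm (x w)
            \<le> (1 / 2 + \<eta> * (real (card B) + \<rho>)) * norm (x w)"
            unfolding card using \<eta>0 \<rho>(1) by (intro mult_right_mono add_mono mult_left_mono) auto
          also have "\<dots> \<le> norm (x w + h)" using bw[of h] sub that by (auto simp: B_def)
          finally show ?thesis .
        qed
        then show ?thesis using B' im wk adm'(1)
          by (intro exI[of _ 1]) (auto intro!: bexI[of _ 0] simp: span_zero)
      next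
        \<comment> \<open>The next distinguished vector \<open>x d\<close> is not below
          \<open>w\<close>, so the distance condition is void and \<rho> = 0 will do.\<close>
        case dw: False
        then have "d \<notin> B" by (auto simp: B_def below_def)
        then have BB: "B - {d} = B" by auto
        have "(1 / 2 + \<eta> * (real (card B) + 0)) * norm (x w) \<le> norm (x w + h)"
          if "h \<in> span (x ` B)" for h
        proof -
          have "(1 / 2 + \<eta> * (real (card B) + 0)) * norm (x w)
            \<le> (1 / 2 + \<eta> * (real (card B) + \<rho>)) * norm (x w)"
            using \<eta>0 \<rho>(1) by (intro mult_right_mono add_mono mult_left_mono) auto
          also have "\<dots> \<le> norm (x w + h)" using bw[of h] that by (auto simp: B_def)
          finally show ?thesis .
        qed
        then show ?thesis using B' im wk adm'(1) dw BB
          by (intro exI[of _ 0]) auto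
      qed
    next
      case False
      then have aw: "a < A w" using Aa[of w] by simp
      define B where "B = below k A w"
      define R where "R = B - {d}"
      have dB: "d \<in> B" and kB: "k \<notin> B" and wB: "w \<notin> B"
        using aw adm' sp by (auto simp: B_def below_def)
      have B': "below d (A(k := a)) w = insert k R"
        using aw wk adm'(1) by (auto simp: below_def B_def R_def)
      have kR: "k \<notin> R" using kB by (simp add: R_def)
      have card: "card (insert k R) = card B"
        using kR dB unfolding R_def by (metis card.remove card_insert_disjoint finite)
      have imR: "x(k := y) ` R = x ` R" by (rule image_cong) (use kR in auto)
      have im: "x(k := y) ` insert k R = insert y (x ` R)" using imR by auto
      have SR: "span (x ` S) \<subseteq> span (x ` R)"
        using aw by (intro span_mono image_mono) (auto simp: S_def R_def B_def below_def)
      have "A k < A w" using aw adm'(2) sp by linarith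
      then obtain h where h: "h \<in> span (x ` B)" "norm (x k - h) \<le> \<rho> * norm (x k)"
        using xkg by (auto simp: B_def)
      define r where "r = x k - h"
      have r\<theta>: "norm r \<le> \<rho> * \<theta>"
        using h(2) mult_left_mono[OF xk \<rho>(1)] by (simp add: r_def)
      have "insert d R = B" using dB by (auto simp: R_def)
      then obtain \<beta> where \<beta>: "h - \<beta> *\<^sub>R x d \<in> span (x ` R)"
        using h(1) by (metis image_insert span_breakdown_eq)
      have nh: "norm h \<le> 2 * \<theta>"
      proof -
        have "norm h \<le> norm (x k) + norm r"
          using norm_triangle_ineq4[of "x k" r] by (simp add: r_def)
        also have "\<rho> * \<theta> \<le> 1 * \<theta>" using \<rho> \<theta>0 by (intro mult_right_mono) auto
        then have "norm (x k) + norm r \<le> 2 * \<theta>" using xk r\<theta> by simp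
        finally show ?thesis .
      qed
      have "\<bar>\<beta>\<bar> * norm (x d) \<le> K * norm (\<beta> *\<^sub>R x d + (h - \<beta> *\<^sub>R x d))"
        unfolding K_def using dB kB \<beta> by (intro reduced_dist[OF red, of B]) (auto simp: R_def)
      also have "\<dots> \<le> K * (2 * \<theta>)" using nh K by (intro mult_left_mono) auto
      also have "\<dots> = 2 * (K * \<theta>)" by simp
      finally have \<beta>d: "\<bar>\<beta>\<bar> * norm (x d) \<le> exp a / 2" using K\<theta>' exp_gt_zero[of a] by linarith
      define \<mu> where "\<mu> = \<beta> + real m"
      have xd0: "0 < norm (x d)" by (rule reduced_nonzero[OF red])
      have "exp a / 2 \<le> real m * norm (x d) - \<bar>\<beta>\<bar> * norm (x d)" using st'(3) \<beta>d by simp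
      also have "\<dots> = (real m - \<bar>\<beta>\<bar>) * norm (x d)" by (simp add: algebra_simps)
      also have "\<dots> \<le> \<mu> * norm (x d)" using xd0 by (intro mult_right_mono) (auto simp: \<mu>_def)
      finally have \<mu>d: "exp a / 2 \<le> \<mu> * norm (x d)" .
      then have \<mu>0: "0 < \<mu>" using xd0 
        by (metis exp_gt_zero half_gt_zero less_le_trans zero_less_mult_pos2)
      define z where "z = (h - \<beta> *\<^sub>R x d) + g"
      have zR: "z \<in> span (x ` R)" unfolding z_def using \<beta> st'(1) SR by (intro span_add) auto
      \<comment> \<open>Modulo the span of \<open>R\<close>, which lies in both the old and the new
        span, \<open>y\<close> is a large multiple of \<open>x d\<close> up to the small error
        \<open>r\<close>. Hence the two spans nearly agree.\<close>
      have y: "y = r + \<mu> *\<^sub>R x d + z"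
        by (simp add: y_def r_def \<mu>_def z_def algebra_simps)
      \<comment> \<open>Solving for \<open>x d\<close> leaves the error \<open>r / \<mu>\<close>.
        The factor 1/2 comes from \<open>norm r \<le> \<rho> * (exp a / 4)\<close> and
        \<open>exp a / 2 \<le> \<mu> * norm (x d)\<close>.\<close>
      have half: "\<exists>g\<in>span (insert y (x ` R)). norm (x d - g) \<le> \<rho> / 2 * norm (x d)"
      proof (rule bexI)
        show "(1 / \<mu>) *\<^sub>R (y - z) \<in> span (insert y (x ` R))"
          using zR span_mono[of "x ` R" "insert y (x ` R)"]
          by (intro span_scale span_diff) (auto intro: span_base)
        have "x d - (1 / \<mu>) *\<^sub>R (y - z) = - ((1 / \<mu>) *\<^sub>R r)"
          using \<mu>0 by (simp add: y algebra_simps)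
        then have "norm (x d - (1 / \<mu>) *\<^sub>R (y - z)) = norm r / \<mu>" using \<mu>0 by simp
        also have "\<dots> \<le> \<rho> / 2 * norm (x d)"
        proof -
          have "\<theta> \<le> exp a / 4" using \<theta>1 exp_gt_zero[of a] by linarith
          then have "norm r \<le> \<rho> * (exp a / 4)"
            using \<rho>(1) by (intro order_trans[OF r\<theta> mult_left_mono]) auto
          also have "\<dots> = \<rho> / 2 * (exp a / 2)" by simp
          also have "\<dots> \<le> \<rho> / 2 * (\<mu> * norm (x d))" using \<mu>d \<rho>(1) by (intro mult_left_mono) auto
          finally show ?thesis using \<mu>0 by (simp add: field_simps)
        qed
        finally show "norm (x d - (1 / \<mu>) *\<^sub>R (y - z)) \<le> \<rho> / 2 * norm (x d)" .
      qed
      define b where "b = 1 / 2 + \<eta> * (real (card B) + \<rho>)"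
      have b1: "0 \<le> b" "b \<le> 1"
      proof -
        show "0 \<le> b" using \<eta>0 \<rho> by (auto simp: b_def)
        have "\<eta> * (real (card B) + \<rho>) \<le> \<eta> * (real CARD('n) + 1)"
          using \<eta>0 \<rho>(2) by (intro mult_left_mono add_mono) (auto simp: card_mono)
        also have "\<dots> \<le> 1 / 4" using n\<eta> by (simp add: algebra_simps)
        finally show "b \<le> 1" by (simp add: b_def)
      qed
      have "(1 / 2 + \<eta> * (real (card B) + \<rho> / 2)) * norm (x w) \<le> norm (x w + f)"
        if f: "f \<in> span (insert y (x ` R))" for f
      proof -
        obtain \<tau> where \<tau>: "f - \<tau> *\<^sub>R y \<in> span (x ` R)"
          using f by (auto simp: span_breakdown_eq)
        define z' where "z' = f - \<tau> *\<^sub>R y + \<tau> *\<^sub>R z"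
        have z'R: "z' \<in> span (x ` R)" unfolding z'_def using \<tau> zR by (intro span_add span_scale)
        \<comment> \<open>\<open>G\<close> differs from \<open>x w\<close> by an element of the old
          span, so the old bound applies to it; \<open>\<tau> *\<^sub>R r\<close> is the whole
          effect of the turn.\<close>
        define G where "G = x w + ((\<tau> * \<mu>) *\<^sub>R x d + z')"
        have fG: "x w + f = G + \<tau> *\<^sub>R r"
          by (simp add: G_def z'_def y algebra_simps)
        have RB: "span (x ` R) \<subseteq> span (x ` B)" by (intro span_mono image_mono) (auto simp: R_def)
        have "(\<tau> * \<mu>) *\<^sub>R x d + z' \<in> span (x ` B)"
          using z'R RB dB by (intro span_add span_scale) (auto intro: span_base)
        then have G1: "b * norm (x w) \<le> norm G" using bw by (simp add: G_def b_def B_def)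
        have "\<bar>\<tau> * \<mu>\<bar> * norm (x d) \<le> K * norm ((\<tau> * \<mu>) *\<^sub>R x d + (x w + z'))"
          unfolding K_def
        proof (rule reduced_dist[OF red, of "insert w B"])
          show "x w + z' \<in> span (x ` (insert w B - {d}))"
          proof (rule span_add)
            show "x w \<in> span (x ` (insert w B - {d}))" using wd by (intro span_base) auto
            have "span (x ` R) \<subseteq> span (x ` (insert w B - {d}))"
              by (intro span_mono image_mono) (auto simp: R_def)
            then show "z' \<in> span (x ` (insert w B - {d}))" using z'R by auto
          qed
        qed (use kB wk dB in auto)
        also have "(\<tau> * \<mu>) *\<^sub>R x d + (x w + z') = G" by (simp add: G_def algebra_simps)
        finally have \<tau>G: "\<bar>\<tau>\<bar> * (\<mu> * norm (x d)) \<le> K * norm G" using \<mu>0 by (simp add: abs_mult mult_ac)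
        have "\<bar>\<tau>\<bar> * (exp a / 2) \<le> \<bar>\<tau>\<bar> * (\<mu> * norm (x d))" using \<mu>d by (intro mult_left_mono) auto
        with \<tau>G have \<tau>a: "\<bar>\<tau>\<bar> * (exp a / 2) \<le> K * norm G" by linarith
        have "norm (\<tau> *\<^sub>R r) * exp a \<le> \<bar>\<tau>\<bar> * (\<rho> * \<theta>) * exp a"
          using r\<theta> by (auto intro!: mult_right_mono mult_left_mono)
        also have "\<dots> = 2 * \<rho> * \<theta> * (\<bar>\<tau>\<bar> * (exp a / 2))" by simp
        also have "\<dots> \<le> 2 * \<rho> * \<theta> * (K * norm G)" using \<tau>a \<rho> \<theta>0 by (intro mult_left_mono) auto
        also have "\<dots> = 2 * \<rho> * (K * \<theta>) * norm G" by simp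
        also have "\<dots> = (\<eta> * \<rho> / 2 * norm G) * exp a" unfolding K\<theta> by simp
        finally have \<tau>r: "norm (\<tau> *\<^sub>R r) \<le> \<eta> * \<rho> / 2 * norm G" by simp
        have \<eta>\<rho>: "\<eta> * \<rho> / 2 \<le> 1"
          using mult_mono[of \<eta> "1/8" \<rho> 1] n\<eta>(2) \<rho> \<eta>0 by simp
        \<comment> \<open>The relative loss \<open>\<eta> * \<rho> / 2\<close> is exactly what is
          given up by passing from \<rho> to \<open>\<rho> / 2\<close>.\<close>
        have "(1 / 2 + \<eta> * (real (card B) + \<rho> / 2)) * norm (x w) = (b - \<eta> * \<rho> / 2 * 1) * norm (x w)"
          by (simp add: b_def algebra_simps)
        also have "\<dots> \<le> (b - \<eta> * \<rho> / 2 * b) * norm (x w)"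
          using b1 \<eta>0 \<rho>(1) by (intro mult_right_mono diff_left_mono mult_left_mono) auto
        also have "\<dots> = (1 - \<eta> * \<rho> / 2) * (b * norm (x w))" by (simp add: algebra_simps)
        also have "\<dots> \<le> (1 - \<eta> * \<rho> / 2) * norm G" using G1 \<eta>\<rho> by (intro mult_left_mono) auto
        also have "\<dots> \<le> norm G - norm (\<tau> *\<^sub>R r)" using \<tau>r by (simp add: algebra_simps)
        also have "\<dots> \<le> norm (x w + f)" unfolding fG by (rule norm_diff_ineq)
        finally show ?thesis .
      qed
      then show ?thesis using B' im card wk adm'(1) half \<rho>
        by (intro exI[of _ "\<rho> / 2"]) auto
    qed
  qed
  ultimately show ?thesis
    unfolding reduced_basis_def y_def[symmetric] \<eta>_def by blast
qed

text \<open>Within the old hyperplane, \<open>f\<close> is dual to \<open>x d\<close>: it has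
  product 1 with \<open>x d\<close> and 0 with the other retained vectors. Subtracting from
  \<open>u\<close> a multiple of \<open>f\<close> thus affects only the product with the new vector,
  which is \<open>u \<bullet> x k\<close> before the correction, hence tiny by
  \<open>unit_normal_bound\<close>. The constant arises as 4 * 3^n * 4^(n-1) = 12^n.\<close>

lemma unit_normal_step:
  fixes x :: "'n::finite \<Rightarrow> real^'n"
  assumes red: "reduced_basis x k A" and adm: "admissible k d A a" and st: "step_vector x k d A a m g"
    and u: "unit_normal u x k"
  obtains u' where "unit_normal u' (x(k := x k + real m *\<^sub>R x d + g)) d"
    "norm (u' - u) \<le> 12 ^ CARD('n) * exp (- ((\<Sum>v\<in>UNIV - {k}. A v) + a))"
proof -
  define y where "y = x k + real m *\<^sub>R x d + g"
  define S where "S = {v. v \<noteq> k \<and> v \<noteq> d \<and> A v < a}"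
  define K where "K = (3::real) ^ CARD('n)"
  define V where "V = UNIV - {k}"
  have K: "1 \<le> K" by (simp add: K_def)
  have adm': "d \<noteq> k" "A k + spacing CARD('n) \<le> a"
    using adm by (auto simp: admissible_def)
  have st': "g \<in> span (x ` S)" "exp a \<le> real m * norm (x d)"
    using st unfolding step_vector_def S_def by blast+
  have u1: "norm u = 1" and u0: "\<And>v. v \<noteq> k \<Longrightarrow> u \<bullet> x v = 0"
    using u by (auto simp: unit_normal_def)
  have xd0: "0 < norm (x d)" by (rule reduced_nonzero[OF red])
  obtain p r where pr: "p \<in> span (x ` (V - {d}))" "x d = p + r"
    "\<And>w. w \<in> span (x ` (V - {d})) \<Longrightarrow> r \<bullet> w = 0"
    by (rule span_orthogonal_decomp[of "x ` (V - {d})" "x d"]) blast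
  have "\<bar>1\<bar> * norm (x d) \<le> 3 ^ CARD('n) * norm (1 *\<^sub>R x d + (- p))"
    by (rule reduced_dist[OF red, of V]) (use pr adm' in \<open>auto simp: V_def span_neg\<close>)
  then have rK: "norm (x d) \<le> K * norm r" using pr(2) by (simp add: K_def)
  then have r0: "0 < norm r" using xd0
    by (metis mult_zero_right norm_ge_zero norm_zero not_less order_le_less)
  define f where "f = (1 / (norm r)\<^sup>2) *\<^sub>R r"
  have nf: "norm f = 1 / norm r" using r0 by (simp add: f_def power2_eq_square)
  have fd: "f \<bullet> x d = 1"
  proof -
    have "r \<bullet> x d = (norm r)\<^sup>2" using pr(3)[OF pr(1)] by (simp add: pr(2) inner_add_right power2_norm_eq_inner)
    then show ?thesis using r0 by (simp add: f_def)
  qed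
  have fv: "f \<bullet> x v = 0" if "v \<noteq> k" "v \<noteq> d" for v
    using pr(3)[of "x v"] that by (simp add: f_def V_def span_base)
  have perp: "z \<bullet> w = 0" if w: "w \<in> span (x ` T)" and z: "\<And>v. v \<in> T \<Longrightarrow> z \<bullet> x v = 0" for z w T
  proof -
    obtain t where "w = (\<Sum>i\<in>T. t i *\<^sub>R x i)" using w by (subst (asm) span_image_iff_sum) auto
    then show ?thesis using z by (simp add: inner_sum_right)
  qed
  have fg: "f \<bullet> g = 0" using st'(1) fv by (rule perp) (auto simp: S_def)
  have ug: "u \<bullet> g = 0" using st'(1) u0 by (rule perp) (auto simp: S_def)
  have up: "u \<bullet> p = 0" using pr(1) u0 by (rule perp) (auto simp: V_def)
  have uf: "u \<bullet> f = 0" using u0[OF adm'(1)] up by (simp add: f_def pr(2) inner_add_right)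
  define \<kappa> where "\<kappa> = u \<bullet> x k"
  define \<mu> where "\<mu> = f \<bullet> y"
  have \<mu>eq: "\<mu> = f \<bullet> x k + real m" by (simp add: \<mu>_def y_def inner_add_right fd fg)
  have uy: "u \<bullet> y = \<kappa>" by (simp add: y_def inner_add_right u0[OF adm'(1)] ug \<kappa>_def)
  have fK: "norm f * norm (x d) \<le> K" using rK r0 by (simp add: nf field_simps)
  have "\<bar>f \<bullet> x k\<bar> * norm (x d) \<le> norm f * norm (x k) * norm (x d)"
    by (intro mult_right_mono Cauchy_Schwarz_ineq2) auto
  also have "\<dots> = norm (x k) * (norm f * norm (x d))" by simp
  also have "\<dots> \<le> norm (x k) * K" using fK by (intro mult_left_mono) auto
  also have "\<dots> \<le> slack CARD('n) / (4 * 3 ^ CARD('n)) * exp a * K"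
    using small_bound[OF red adm'(2)] K by (intro mult_right_mono) auto
  also have "\<dots> = slack CARD('n) * (exp a / 4)" by (simp add: K_def)
  also have "\<dots> \<le> 1 / 8 * (exp a / 4)" using slack_card'[where 'n='n] by (intro mult_right_mono) auto
  finally have "\<bar>f \<bullet> x k\<bar> * norm (x d) \<le> 1 / 8 * (exp a / 4)" .
  then have "\<bar>f \<bullet> x k\<bar> * norm (x d) \<le> exp a / 2" using exp_gt_zero[of a] by linarith
  then have "exp a / 2 \<le> (real m - \<bar>f \<bullet> x k\<bar>) * norm (x d)"
    using st'(2) by (simp add: algebra_simps)
  also have "\<dots> \<le> \<mu> * norm (x d)" by (intro mult_right_mono) (auto simp: \<mu>eq)
  finally have \<mu>d: "exp a / 2 \<le> \<mu> * norm (x d)" .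
  then have \<mu>0: "0 < \<mu>" using xd0
    by (metis exp_gt_zero half_gt_zero less_le_trans zero_less_mult_pos2)
  define q where "q = u - (\<kappa> / \<mu>) *\<^sub>R f"
  have "norm u \<le> norm (u + (- (\<kappa> / \<mu>) *\<^sub>R f))"
    by (rule norm_le_add_orthogonal) (simp add: uf)
  then have q1: "1 \<le> norm q" using u1 by (simp add: q_def)
  have qy: "q \<bullet> y = 0" using \<mu>0 uy by (simp add: q_def inner_diff_left \<mu>_def)
  have qv: "q \<bullet> x v = 0" if "v \<noteq> k" "v \<noteq> d" for v
    using that fv u0 by (simp add: q_def inner_diff_left)
  define u' where "u' = (1 / norm q) *\<^sub>R q"
  have "unit_normal u' (x(k := y)) d"
    using q1 qy qv by (auto simp: unit_normal_def u'_def)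
  moreover have "norm (u' - u) \<le> 12 ^ CARD('n) * exp (- ((\<Sum>v\<in>UNIV - {k}. A v) + a))"
  proof -
    have qu: "norm (q - u) = \<bar>\<kappa>\<bar> * norm f / \<mu>" using \<mu>0 by (simp add: q_def abs_mult)
    have q0: "0 < norm q" using q1 by linarith
    then have q2: "1 / norm q \<le> 1" using q1 by (subst divide_le_eq_1_pos)
    \<comment> \<open>Normalising at most doubles the displacement: it moves \<open>q\<close> by
      \<open>norm q - 1\<close>, which is at most \<open>norm (q - u)\<close>.\<close>
    have "u' - q = (1 / norm q - 1) *\<^sub>R q" by (simp add: u'_def algebra_simps)
    then have "norm (u' - q) = \<bar>1 / norm q - 1\<bar> * norm q" by simp
    also have "\<bar>1 / norm q - 1\<bar> = 1 - 1 / norm q" using q2 by simp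
    also have "(1 - 1 / norm q) * norm q = norm q - 1" using q0 by (simp add: field_simps)
    also have "\<dots> \<le> norm (q - u)" using norm_triangle_ineq2[of q u] u1 by simp
    finally have "norm (u' - u) \<le> 2 * norm (q - u)"
      using norm_triangle_ineq[of "u' - q" "q - u"] by simp
    also have "\<dots> \<le> 4 * K * \<bar>\<kappa>\<bar> * exp (- a)"
    proof -
      have "norm f * exp a \<le> norm f * (2 * (\<mu> * norm (x d)))"
        using \<mu>d by (intro mult_left_mono) auto
      also have "\<dots> = 2 * \<mu> * (norm f * norm (x d))" by simp
      also have "\<dots> \<le> 2 * \<mu> * K" using fK \<mu>0 by (intro mult_left_mono) auto
      finally have "norm f / \<mu> \<le> 2 * K * exp (- a)" using \<mu>0 by (simp add: exp_minus field_simps)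
      from mult_left_mono[OF this, of "2 * \<bar>\<kappa>\<bar>"] show ?thesis by (simp add: qu mult_ac)
    qed
    also have "\<dots> \<le> 4 * K * (4 ^ (CARD('n) - 1) * exp (- (\<Sum>v\<in>UNIV - {k}. A v))) * exp (- a)"
      using unit_normal_bound[OF red u] K
      by (intro mult_right_mono mult_left_mono) (auto simp: \<kappa>_def)
    also have "\<dots> = (4 * 4 ^ (CARD('n) - 1)) * K * (exp (- (\<Sum>v\<in>UNIV - {k}. A v)) * exp (- a))"
      by simp
    also have "4 * 4 ^ (CARD('n) - 1) = (4::real) ^ CARD('n)"
      by (metis One_nat_def Suc_pred power_Suc zero_less_card_finite)
    also have "4 ^ CARD('n) * K = 12 ^ CARD('n)"
      by (simp add: K_def flip: power_mult_distrib)
    finally show ?thesis by (simp flip: exp_add)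
  qed
  ultimately show thesis by (rule that[unfolded y_def[symmetric]])
qed

subsection \<open>Moving between cells\<close>

definition width :: "nat \<Rightarrow> real" where
  "width n = real n * spacing n"

text \<open>
  The logarithmic scale is cut into cells of length \<open>width n\<close>, each offering \<open>n\<close> places
  at mutual distance \<open>spacing n\<close>, so that a new vector always finds a free place in a
  prescribed cell. Cell \<open>0\<close> is special: it holds the vectors of the standard basis. For the
  free index \<open>k\<close>, the number \<open>c k\<close> is the cell where its replacement would be put now.
\<close>

definition cell_state ::
    "('n::finite \<Rightarrow> real^'n) \<Rightarrow> 'n \<Rightarrow> ('n \<Rightarrow> real) \<Rightarrow> real^'n \<Rightarrow> ('n \<Rightarrow> nat) \<Rightarrow> bool" where
  "cell_state x k A u c \<longleftrightarrow> reduced_basis x k A \<and> unit_normal u x k \<and> 1 \<le> c k \<and>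
     A k + spacing CARD('n) \<le> real (c k) * width CARD('n) \<and>
     (\<forall>v. v \<noteq> k \<longrightarrow> c v = 0 \<and> A v \<le> 0 \<or>
        1 \<le> c v \<and> (\<exists>p::nat. A v = spacing CARD('n) * real p \<and> p div CARD('n) = c v))"

text \<open>Twice the bound of \<open>unit_normal_step\<close>, with \<open>a\<close> replaced by
  the lower end of cell \<open>c k\<close>. A switch spends at most half of it on the turn and
  leaves at most half as the new radius, so the balls around successive normals are nested.\<close>

definition radius :: "'n::finite \<Rightarrow> ('n \<Rightarrow> real) \<Rightarrow> ('n \<Rightarrow> nat) \<Rightarrow> real" where
  "radius k A c =
     2 * 12 ^ CARD('n) * exp (- ((\<Sum>v\<in>UNIV - {k}. A v) + real (c k) * width CARD('n)))"

lemma width_ge_spacing: "spacing CARD('n::finite) \<le> width CARD('n)"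
proof -
  have "1 * spacing CARD('n) \<le> real CARD('n) * spacing CARD('n)"
    using spacing_pos by (intro mult_right_mono) (auto simp: Suc_leI less_imp_le)
  then show ?thesis by (simp add: width_def)
qed

lemma width_pos: "0 < width CARD('n::finite)"
  using width_ge_spacing[where 'n='n] spacing_pos[of "CARD('n)"] by linarith

text \<open>The topmost place of a cell lies one spacing below the upper end, so that separation
  also holds across the border to the next cell.\<close>

lemma cell_state_upper:
  fixes A :: "'n::finite \<Rightarrow> real"
  assumes "cell_state x k A u c" "v \<noteq> k"
  shows "A v + spacing CARD('n) \<le> (real (c v) + 1) * width CARD('n)"
proof -
  consider "c v = 0" "A v \<le> 0" | p :: nat where "A v = spacing CARD('n) * real p" "p div CARD('n) = c v"
    using assms unfolding cell_state_def by metis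
  then show ?thesis
  proof cases
    case 1
    then show ?thesis using width_ge_spacing[where 'n='n] by simp
  next
    case 2
    have "p < CARD('n) * (c v + 1)"
      using 2(2) dividend_less_times_div[of "CARD('n)" p] by simp
    then have "p + 1 \<le> CARD('n) * (c v + 1)" by simp
    then have "real p + 1 \<le> real CARD('n) * (real (c v) + 1)"
      by (metis of_nat_1 of_nat_add of_nat_le_iff of_nat_mult)
    from mult_left_mono[OF this, of "spacing CARD('n)"] show ?thesis
      using spacing_pos[of "CARD('n)"] by (simp add: 2(1) width_def algebra_simps)
  qed
qed

lemma cell_state_lower:
  fixes A :: "'n::finite \<Rightarrow> real"
  assumes "cell_state x k A u c" "v \<noteq> k" "1 \<le> c v"
  shows "real (c v) * width CARD('n) \<le> A v"
proof -
  obtain p :: nat where p: "A v = spacing CARD('n) * real p" "p div CARD('n) = c v"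
    using assms unfolding cell_state_def by force
  have "CARD('n) * c v \<le> p" unfolding p(2)[symmetric] by (rule times_div_less_eq_dividend)
  then have "real CARD('n) * real (c v) \<le> real p" by (metis of_nat_le_iff of_nat_mult)
  from mult_left_mono[OF this, of "spacing CARD('n)"] show ?thesis
    using spacing_pos[of "CARD('n)"] by (simp add: p(1) width_def algebra_simps)
qed

text \<open>While \<open>x k\<close> is distinguished, a rise of its component only postpones the
  replacement to a higher cell; no vector changes, and a later replacement turns the normal
  less.\<close>

lemma cell_state_advance:
  fixes A :: "'n::finite \<Rightarrow> real"
  assumes "cell_state x k A u c"
  shows "cell_state x k A u (c(k := Suc (c k)))" "radius k A (c(k := Suc (c k))) \<le> radius k A c"
  using assms width_pos[where 'n='n] unfolding cell_state_def radius_def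
  by (auto simp: algebra_simps)

text \<open>The replacement of \<open>x k\<close> is fixed in the cell \<open>c k\<close>, and
  \<open>x d\<close>, from a lower cell, becomes distinguished with target cell
  \<open>t\<close>.\<close>

lemma cell_state_switch:
  fixes A :: "'n::finite \<Rightarrow> real"
  assumes cs: "cell_state x k A u c" and d: "d \<noteq> k" "c d < c k" "c d < t"
  obtains x' A' u' where "cell_state x' d A' u' (c(d := t))"
    "norm (u' - u) + radius d A' (c(d := t)) \<le> radius k A c"
proof -
  define \<delta> where "\<delta> = spacing CARD('n)"
  define n where "n = CARD('n)"
  define h where "h = width n"
  have \<delta>0: "0 < \<delta>" unfolding \<delta>_def by (rule spacing_pos)
  have h: "h = real n * \<delta>" by (simp add: h_def width_def n_def \<delta>_def)
  have h0: "0 < h" using width_pos[where 'n='n] by (simp add: h_def n_def)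
  have \<delta>h: "\<delta> \<le> h" using width_ge_spacing[where 'n='n] by (simp add: h_def n_def \<delta>_def)
  have red: "reduced_basis x k A" and un: "unit_normal u x k" and ck: "1 \<le> c k"
    and Ak: "A k + \<delta> \<le> real (c k) * h"
    and Av: "\<And>v. v \<noteq> k \<Longrightarrow> c v = 0 \<and> A v \<le> 0 \<or> 1 \<le> c v \<and> (\<exists>p::nat. A v = \<delta> * real p \<and> p div n = c v)"
    using cs unfolding cell_state_def \<delta>_def h_def n_def by blast+
  \<comment> \<open>The number of the place held by \<open>v\<close>. In cell 0 the value may be
    arbitrary, which blocks at most one further place per vector; n places against n - 1 vectors
    still leave one free.\<close>
  define f where "f v = (SOME p::nat. A v = \<delta> * real p)" for v
  have f: "A v = \<delta> * real (f v)" if "v \<noteq> k" "c v \<noteq> 0" for v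
  proof -
    have "\<exists>p::nat. A v = \<delta> * real p" using Av[OF that(1)] that(2) by auto
    then show ?thesis unfolding f_def by (rule someI_ex)
  qed
  have "card (f ` (UNIV - {k})) \<le> card (UNIV - {k})" by (rule card_image_le) simp
  also have "\<dots> < n" unfolding n_def by (simp add: card_Diff_singleton)
  also have "n = card {n * c k..<n * c k + n}" by simp
  finally have "\<not> {n * c k..<n * c k + n} \<subseteq> f ` (UNIV - {k})"
    by (meson card_mono finite finite_imageI not_less)
  then obtain p where p: "n * c k \<le> p" "p < n * c k + n" "p \<notin> f ` (UNIV - {k})"
    by (meson atLeastLessThan_iff subsetI)
  define a where "a = \<delta> * real p"
  have pdiv: "p div n = c k"
  proof (rule div_nat_eqI)
    show "n * c k \<le> p" by (rule p(1))
    show "p < n * Suc (c k)" using p(2) by simp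
  qed
  have "real n * real (c k) \<le> real p" using p(1) by (metis of_nat_le_iff of_nat_mult)
  from mult_left_mono[OF this, of \<delta>] have ha: "real (c k) * h \<le> a"
    using \<delta>0 by (simp add: a_def h mult_ac)
  have "1 * h \<le> real (c k) * h" using ck h0 by (intro mult_right_mono) auto
  with ha have h_a: "h \<le> a" by simp
  have up: "A v + \<delta> \<le> (real (c v) + 1) * h" if "v \<noteq> k" for v
    using cell_state_upper[OF cs that] by (simp add: \<delta>_def h_def n_def)
  have Ad: "A d + \<delta> \<le> a"
  proof -
    have "(real (c d) + 1) * h \<le> real (c k) * h" using d(2) h0 by (intro mult_right_mono) auto
    then show ?thesis using up[OF d(1)] ha by linarith
  qed
  have adm: "admissible k d A a"
    unfolding admissible_def \<delta>_def[symmetric]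
  proof (intro conjI allI impI)
    fix v assume v: "v \<noteq> k"
    show "A v + \<delta> \<le> a \<or> a + \<delta> \<le> A v"
    proof (cases "c v = 0")
      case True
      then have "A v \<le> 0" using Av[OF v] by auto
      then show ?thesis using \<delta>h h_a by auto
    next
      case False
      have "f v \<noteq> p" using p(3) v by auto
      then have "f v + 1 \<le> p \<or> p + 1 \<le> f v" by linarith
      then have "real (f v) + 1 \<le> real p \<or> real p + 1 \<le> real (f v)" by linarith
      then have "\<delta> * (real (f v) + 1) \<le> \<delta> * real p \<or> \<delta> * (real p + 1) \<le> \<delta> * real (f v)"
        using \<delta>0 by (auto intro: mult_left_mono)
      then show ?thesis using f[OF v False] by (auto simp: a_def algebra_simps)
    qed
  qed (use d Ad Ak ha in auto)
  obtain m g where st: "step_vector x k d A a m g" by (rule ex_step_vector[OF red adm])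
  define y where "y = x k + real m *\<^sub>R x d + g"
  obtain u' where u': "unit_normal u' (x(k := y)) d"
    and u'u: "norm (u' - u) \<le> 12 ^ n * exp (- ((\<Sum>v\<in>UNIV - {k}. A v) + a))"
    using unit_normal_step[OF red adm st un] unfolding y_def n_def by blast
  define A' where "A' = A(k := a)"
  have red': "reduced_basis (x(k := y)) d A'"
    unfolding y_def A'_def by (rule reduced_step[OF red adm st])
  have "(real (c d) + 1) * h \<le> real t * h" using d(3) h0 by (intro mult_right_mono) auto
  then have Adt: "A d + \<delta> \<le> real t * h" using up[OF d(1)] by linarith
  have "cell_state (x(k := y)) d A' u' (c(d := t))"
    unfolding cell_state_def \<delta>_def[symmetric] n_def[symmetric] h_def[symmetric]
    using red' u' d Adt ck Av pdiv by (auto simp: A'_def a_def \<delta>_def n_def)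
  moreover have "norm (u' - u) + radius d A' (c(d := t)) \<le> radius k A c"
  proof -
    define s where "s = (\<Sum>v\<in>UNIV - {k}. A v)"
    have "(\<Sum>v\<in>UNIV - {d}. A' v) = A' k + (\<Sum>v\<in>UNIV - {d} - {k}. A' v)"
      using d(1) by (intro sum.remove) auto
    also have "(\<Sum>v\<in>UNIV - {d} - {k}. A' v) = (\<Sum>v\<in>UNIV - {k} - {d}. A v)"
      by (rule sum.cong) (auto simp: A'_def)
    also have "\<dots> = s - A d" unfolding s_def using d(1) by (subst (2) sum.remove[of _ d]) auto
    finally have s': "(\<Sum>v\<in>UNIV - {d}. A' v) = s + a - A d" by (simp add: A'_def)
    \<comment> \<open>Half of the old radius. The turn costs at most \<open>R\<close>, and so does
      the new ball: its exponent improves by at least one spacing, and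
      \<open>2 * exp (- \<delta>) \<le> 1\<close>.\<close>
    define R where "R = 12 ^ n * exp (- (s + real (c k) * h))"
    have R: "radius k A c = 2 * R" by (simp add: radius_def R_def s_def n_def h_def)
    have "norm (u' - u) \<le> R"
      unfolding R_def s_def using ha by (intro order_trans[OF u'u]) auto
    moreover have "radius d A' (c(d := t)) \<le> R"
    proof -
      have "radius d A' (c(d := t)) = 2 * 12 ^ n * exp (- (s + a - A d + real t * h))"
        by (simp add: radius_def s' n_def h_def)
      also have "\<dots> \<le> 2 * 12 ^ n * exp (- (s + real (c k) * h) - \<delta>)"
        using ha Adt by simp
      also have "\<dots> = R * (2 * exp (- \<delta>))" by (simp add: R_def exp_diff exp_minus exp_add field_simps)
      also have "\<dots> \<le> R * 1"
      proof (rule mult_left_mono)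
        have "2 \<le> exp \<delta>" using exp_ge_add_one_self[of \<delta>] by (simp add: \<delta>_def spacing_def)
        then show "2 * exp (- \<delta>) \<le> 1" by (simp add: exp_minus field_simps)
      qed (simp add: R_def)
      finally show ?thesis by simp
    qed
    ultimately show ?thesis using R by simp
  qed
  ultimately show thesis by (rule that)
qed

lemma cell_state_initial:
  fixes k :: "'n::finite"
  assumes "1 \<le> t"
  obtains x A u where "cell_state x k A u ((\<lambda>i. 0)(k := t))"
proof -
  obtain A :: "'n \<Rightarrow> real" where A: "inj A" "\<And>i. - (1/2) < A i" "\<And>i. A i \<le> 0"
    by (rule ex_inj_real) blast
  define x :: "'n \<Rightarrow> real^'n" where "x i = axis i 1" for i
  have nx: "norm (x i) = 1" for i by (simp add: x_def norm_axis_1)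
  have orth: "x i \<bullet> x j = (if i = j then 1 else 0)" for i j
    by (simp add: x_def inner_axis_axis)
  have e: "exp (A i) \<le> 1" "1 \<le> 2 * exp (A i)" for i
    using A(2,3)[of i] exp_ge_add_one_self[of "A i"] by (simp, linarith)
  have "det (\<chi> i. x i) = 1"
  proof -
    have "(\<chi> i. x i) = mat 1" by (simp add: vec_eq_iff x_def mat_def axis_def)
    then show ?thesis by simp
  qed
  moreover have "\<exists>\<rho>. 0 \<le> \<rho> \<and> \<rho> \<le> 1 \<and>
        (\<forall>g\<in>span (x ` below k A w).
           (1 / 2 + slack CARD('n) * (real (card (below k A w)) + \<rho>)) * norm (x w) \<le> norm (x w + g)) \<and>
        (A k < A w \<longrightarrow> (\<exists>g\<in>span (x ` below k A w). norm (x k - g) \<le> \<rho> * norm (x k)))" for w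
  proof (intro exI[of _ 1] conjI ballI impI)
    fix g assume "g \<in> span (x ` below k A w)"
    then obtain s where "g = (\<Sum>i\<in>below k A w. s i *\<^sub>R x i)"
      by (subst (asm) span_image_iff_sum) auto
    moreover have "w \<notin> below k A w" by (simp add: below_def)
    ultimately have "x w \<bullet> g = 0" by (auto simp: inner_sum_right orth intro!: sum.neutral)
    from norm_le_add_orthogonal[OF this] have "1 \<le> norm (x w + g)" by (simp add: nx)
    moreover have "slack CARD('n) * (real (card (below k A w)) + 1) \<le> slack CARD('n) * (real CARD('n) + 1)"
      using slack_pos[of "CARD('n)"] by (intro mult_left_mono) (auto simp: card_mono)
    moreover have "slack CARD('n) * (real CARD('n) + 1) \<le> 1 / 4"
      using slack_card[where 'n='n] slack_card'[where 'n='n] by (simp add: algebra_simps)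
    ultimately show "(1 / 2 + slack CARD('n) * (real (card (below k A w)) + 1)) * norm (x w)
      \<le> norm (x w + g)" by (simp add: nx)
  qed (auto intro!: bexI[of _ 0] simp: span_zero)
  moreover have "x i \<in> integer_points" for i by (simp add: x_def integer_points_axis)
  moreover have "exp (A i) / 2 \<le> norm (x i) \<and> norm (x i) \<le> 2 * exp (A i)" for i
    using e[of i] nx[of i] by linarith
  ultimately have "reduced_basis x k A"
    unfolding reduced_basis_def using A(1) by blast
  moreover have "unit_normal (x k) x k" by (auto simp: unit_normal_def nx orth)
  moreover have "A k + spacing CARD('n) \<le> real t * width CARD('n)"
  proof -
    have "1 * width CARD('n) \<le> real t * width CARD('n)"
      using assms width_pos[where 'n='n] by (intro mult_right_mono) auto
    then show ?thesis using A(3)[of k] width_ge_spacing[where 'n='n] by simp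
  qed
  ultimately have "cell_state x k A (x k) ((\<lambda>i. 0)(k := t))"
    using assms A(3) by (auto simp: cell_state_def)
  then show thesis by (rule that)
qed

text \<open>Indices leave cell 0 one at a time: the current free index is fixed in its cell, and the
  next one becomes free. A switch only asks for a start in a lower cell, and 0 is below every
  \<open>c i\<close>, so any order works and any index can be the last. In the induction,
  \<open>F\<close> holds the indices already fixed.\<close>

lemma cell_state_exists:
  fixes c :: "'n::finite \<Rightarrow> nat"
  assumes c: "\<And>i. 1 \<le> c i"
  obtains x A u where "cell_state x k A u c"
proof -
  have "\<exists>x A u. cell_state x j A u (\<lambda>i. if i \<in> insert j F then c i else 0)"
    if "finite F" "j \<notin> F" for F j
    using that
  proof (induction F arbitrary: j)
    case empty
    have "(\<lambda>i. if i \<in> insert j {} then c i else 0) = (\<lambda>i. 0)(j := c j)" by auto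
    then show ?case using cell_state_initial[OF c[of j], of j] by metis
  next
    case (insert i F)
    define b where "b = (\<lambda>l. if l \<in> insert i F then c l else 0)"
    obtain x A u where cs: "cell_state x i A u b"
      using insert.IH[OF insert.hyps(2)] unfolding b_def by blast
    have "b j = 0" using insert.prems by (simp add: b_def)
    moreover have "1 \<le> b i" "1 \<le> c j" using c by (auto simp: b_def)
    ultimately obtain x' A' u' where "cell_state x' j A' u' (b(j := c j))"
      using cell_state_switch[OF cs, of j "c j"] insert.prems by force
    moreover have "b(j := c j) = (\<lambda>l. if l \<in> insert j (insert i F) then c l else 0)"
      by (auto simp: b_def)
    ultimately show ?case by metis
  qed
  from this[of "UNIV - {k}" k] show thesis using that
    by (auto simp: insert_absorb)
qed

text \<open>Allowing every \<open>w\<close> in the ball makes the bounds valid for the normals of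
  all later states. As the cells add up to at least \<open>q\<close>, both the radius and the
  product of \<open>u\<close> with \<open>x k\<close> have order \<open>exp (- q)\<close> or, for
  the latter, the size permitted by the cell of \<open>k\<close>.\<close>

lemma cell_state_bounds:
  fixes x :: "'n::finite \<Rightarrow> real^'n"
  assumes cs: "cell_state x k A u c" and c: "\<And>i. 1 \<le> c i"
    and q: "q \<le> (\<Sum>i\<in>UNIV. real (c i) * width CARD('n))"
    and w: "norm (w - u) \<le> radius k A c"
  shows "norm (x i) \<le> 8 * 12 ^ CARD('n) * exp ((real (c i) + 1) * width CARD('n))"
    and "\<bar>x i \<bullet> w\<bar> \<le> 8 * 12 ^ CARD('n) * exp ((real (c i) + 1) * width CARD('n) - q)"
proof -
  define h where "h = width CARD('n)"
  define G where "G = (12::real) ^ CARD('n)"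
  define s where "s = (\<Sum>v\<in>UNIV - {k}. A v)"
  have h0: "0 < h" using width_pos by (simp add: h_def)
  have G1: "1 \<le> G" by (simp add: G_def)
  have red: "reduced_basis x k A" and un: "unit_normal u x k" using cs by (auto simp: cell_state_def)
  have Ai: "A i \<le> (real (c i) + 1) * h"
  proof (cases "i = k")
    case True
    have "A k + spacing CARD('n) \<le> real (c k) * h" using cs by (simp add: cell_state_def h_def)
    then show ?thesis using True h0 spacing_pos[of "CARD('n)"] by (simp add: algebra_simps)
  next
    case False
    then show ?thesis using cell_state_upper[OF cs False] spacing_pos[of "CARD('n)"] by (simp add: h_def)
  qed
  have xi: "norm (x i) \<le> 2 * exp ((real (c i) + 1) * h)"
  proof -
    have "norm (x i) \<le> 2 * exp (A i)" using red by (simp add: reduced_basis_def)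
    with Ai show ?thesis by (meson exp_le_cancel_iff mult_left_mono order_trans zero_le_numeral)
  qed
  have "2 * exp ((real (c i) + 1) * h) \<le> 8 * G * exp ((real (c i) + 1) * h)"
    using G1 by (intro mult_right_mono) auto
  with xi show "norm (x i) \<le> 8 * 12 ^ CARD('n) * exp ((real (c i) + 1) * width CARD('n))"
    unfolding G_def h_def by (rule order_trans)
  have qs: "q \<le> s + real (c k) * h"
  proof -
    have "q \<le> real (c k) * h + (\<Sum>v\<in>UNIV - {k}. real (c v) * h)"
      using q by (simp add: h_def sum.remove[of UNIV k])
    also have "(\<Sum>v\<in>UNIV - {k}. real (c v) * h) \<le> s"
      unfolding s_def h_def using c by (intro sum_mono cell_state_lower[OF cs]) auto
    finally show ?thesis by simp
  qed
  have wu: "norm (w - u) \<le> 2 * G * exp (- q)"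
  proof -
    have "radius k A c \<le> 2 * G * exp (- q)"
      using qs G1 by (simp add: radius_def G_def s_def h_def)
    with w show ?thesis by simp
  qed
  have "\<bar>x i \<bullet> (w - u)\<bar> \<le> norm (x i) * norm (w - u)" by (rule Cauchy_Schwarz_ineq2)
  also have "\<dots> \<le> (2 * exp ((real (c i) + 1) * h)) * (2 * G * exp (- q))"
    using xi wu by (intro mult_mono) auto
  also have "\<dots> = 4 * G * exp ((real (c i) + 1) * h - q)" by (simp add: exp_diff exp_minus field_simps)
  finally have d: "\<bar>x i \<bullet> (w - u)\<bar> \<le> 4 * G * exp ((real (c i) + 1) * h - q)" .
  have "\<bar>x i \<bullet> u\<bar> \<le> 4 * G * exp ((real (c i) + 1) * h - q)"
  proof (cases "i = k")
    case True
    have "\<bar>x i \<bullet> u\<bar> \<le> 4 ^ (CARD('n) - 1) * exp (- s)"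
      using unit_normal_bound[OF red un] True by (simp add: inner_commute s_def)
    also have "\<dots> \<le> (4 * G) * exp ((real (c i) + 1) * h - q)"
    proof (rule mult_mono)
      have "(4::real) ^ (CARD('n) - 1) \<le> 4 ^ CARD('n)" by (intro power_increasing) auto
      also have "\<dots> \<le> G" unfolding G_def by (intro power_mono) auto
      finally show "4 ^ (CARD('n) - 1) \<le> 4 * G" using G1 by linarith
      show "exp (- s) \<le> exp ((real (c i) + 1) * h - q)"
        using qs h0 True by (simp add: algebra_simps)
    qed (use G1 in auto)
    finally show ?thesis .
  next
    case False
    then have "x i \<bullet> u = 0" using un by (simp add: unit_normal_def inner_commute)
    then show ?thesis using G1 by simp
  qed
  then show "\<bar>x i \<bullet> w\<bar> \<le> 8 * 12 ^ CARD('n) * exp ((real (c i) + 1) * width CARD('n) - q)"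
    using d by (simp add: inner_diff_right G_def h_def)
qed

subsection \<open>Successive minima\<close>

lemma finite_integer_points_bounded: "finite {x \<in> integer_points :: (real^'n) set. norm x \<le> R}"
proof -
  let ?T = "{r::real \<in> \<int>. \<bar>r\<bar> \<le> R}"
  have "{x \<in> integer_points :: (real^'n) set. norm x \<le> R} \<subseteq> vec_lambda ` (UNIV \<rightarrow>\<^sub>E ?T)"
  proof
    fix x :: "real^'n" assume x: "x \<in> {x \<in> integer_points. norm x \<le> R}"
    then have "\<bar>x $ i\<bar> \<le> R" for i using component_le_norm_cart[of x i] by simp
    with x have "vec_nth x \<in> UNIV \<rightarrow>\<^sub>E ?T" by (auto simp: integer_points_def)
    then have "vec_lambda (vec_nth x) \<in> vec_lambda ` (UNIV \<rightarrow>\<^sub>E ?T)" by (rule imageI)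
    then show "x \<in> vec_lambda ` (UNIV \<rightarrow>\<^sub>E ?T)" by (simp add: vec_lambda_eta)
  qed
  moreover have "finite (vec_lambda ` (UNIV \<rightarrow>\<^sub>E ?T) :: (real^'n) set)"
    by (rule finite_imageI, rule finite_PiE) (simp_all add: finite_abs_int_segment)
  ultimately show ?thesis by (rule finite_subset)
qed

definition fits :: "real^'n \<Rightarrow> nat \<Rightarrow> real \<Rightarrow> real \<Rightarrow> bool" where
  "fits u j q L \<longleftrightarrow> (\<exists>S. finite S \<and> card S = j \<and> independent S \<and> S \<subseteq> integer_points \<and>
     (\<forall>x\<in>S. norm x \<le> exp L \<and> \<bar>x \<bullet> u\<bar> \<le> exp (L - q)))"

lemma dilated_convex_body:
  "x \<in> (*\<^sub>R) (exp L) ` convex_body u q \<longleftrightarrow> norm x \<le> exp L \<and> \<bar>x \<bullet> u\<bar> \<le> exp (L - q)"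
proof
  assume "x \<in> (*\<^sub>R) (exp L) ` convex_body u q"
  then obtain y where y: "x = exp L *\<^sub>R y" "norm y \<le> 1" "\<bar>y \<bullet> u\<bar> \<le> exp (- q)"
    by (auto simp: convex_body_def)
  have "exp L * \<bar>y \<bullet> u\<bar> \<le> exp L * exp (- q)" using y(3) by (intro mult_left_mono) auto
  then show "norm x \<le> exp L \<and> \<bar>x \<bullet> u\<bar> \<le> exp (L - q)"
    using y(2) by (auto simp: y(1) abs_mult exp_diff exp_minus field_simps)
next
  assume x: "norm x \<le> exp L \<and> \<bar>x \<bullet> u\<bar> \<le> exp (L - q)"
  define y where "y = exp (- L) *\<^sub>R x"
  have "x = exp L *\<^sub>R y" by (simp add: y_def flip: exp_add)
  moreover have "norm y \<le> 1" using x by (simp add: y_def exp_minus field_simps)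
  moreover have "\<bar>y \<bullet> u\<bar> \<le> exp (- q)"
  proof -
    have "\<bar>y \<bullet> u\<bar> = exp (- L) * \<bar>x \<bullet> u\<bar>" by (simp add: y_def abs_mult)
    also have "\<dots> \<le> exp (- L) * exp (L - q)" using x by (intro mult_left_mono) auto
    finally show ?thesis by (simp flip: exp_add)
  qed
  ultimately show "x \<in> (*\<^sub>R) (exp L) ` convex_body u q"
    by (intro image_eqI[of _ _ y]) (simp_all add: convex_body_def)
qed

lemma log_minimum_eq: "log_minimum u j q = (LEAST L. 0 \<le> L \<and> fits u j q L)"
proof -
  have "S \<subseteq> integer_points \<inter> (*\<^sub>R) (exp L) ` convex_body u q \<longleftrightarrow>
    S \<subseteq> integer_points \<and> (\<forall>x\<in>S. norm x \<le> exp L \<and> \<bar>x \<bullet> u\<bar> \<le> exp (L - q))" for S L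
    unfolding Int_subset_iff by (simp only: subset_iff[of S "(*\<^sub>R) (exp L) ` convex_body u q"] dilated_convex_body Ball_def)
  then show ?thesis unfolding log_minimum_def fits_def by (simp only:)
qed

lemma fits_mono:
  assumes "fits u j q L" "L \<le> M"
  shows "fits u j q M"
proof -
  have "exp L \<le> exp M" "exp (L - q) \<le> exp (M - q)" using assms(2) by simp_all
  then have "norm x \<le> exp M \<and> \<bar>x \<bullet> u\<bar> \<le> exp (M - q)"
    if "norm x \<le> exp L \<and> \<bar>x \<bullet> u\<bar> \<le> exp (L - q)" for x
    using that by linarith
  then show ?thesis using assms(1) unfolding fits_def by blast
qed

text \<open>Up to the bound \<open>L0\<close>, where vectors of the standard basis fit, only
  finitely many sets of integer points compete, and each has a least dilation, the maximum of
  \<open>lam\<close> on it. So the minimum is attained.\<close>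

lemma ex_least_fit:
  fixes u :: "real^'n::finite"
  assumes u: "norm u = 1" and j: "1 \<le> j" "j \<le> CARD('n)"
  obtains L where "0 \<le> L" "fits u j q L" "\<And>M. 0 \<le> M \<Longrightarrow> fits u j q M \<Longrightarrow> L \<le> M"
proof -
  define L0 where "L0 = max 0 q"
  \<comment> \<open>The least nonnegative dilation that admits a nonzero \<open>x\<close>. If
    \<open>x \<bullet> u = 0\<close>, the second constraint is void, and 0 stands in for a logarithm
    of zero.\<close>
  define lam :: "real^'n \<Rightarrow> real" where "lam x = Max {0, ln (norm x), if x \<bullet> u = 0 then 0 else q + ln \<bar>x \<bullet> u\<bar>}" for x
  have lam: "lam x \<le> L \<longleftrightarrow> norm x \<le> exp L \<and> \<bar>x \<bullet> u\<bar> \<le> exp (L - q)" if "0 \<le> L" "x \<noteq> 0" for x L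
  proof -
    have "ln (norm x) \<le> L \<longleftrightarrow> norm x \<le> exp L"
      using that by (metis exp_le_cancel_iff exp_ln zero_less_norm_iff)
    moreover have "q + ln \<bar>x \<bullet> u\<bar> \<le> L \<longleftrightarrow> \<bar>x \<bullet> u\<bar> \<le> exp (L - q)" if "x \<bullet> u \<noteq> 0"
      using that by (metis add.commute exp_le_cancel_iff exp_ln le_diff_eq zero_less_abs_iff)
    ultimately show ?thesis using that by (auto simp: lam_def)
  qed
  define F :: "(real^'n) set set" where "F = {S. S \<subseteq> {x \<in> integer_points. norm x \<le> exp L0} \<and> card S = j \<and> independent S}"
  have finF: "finite F"
    using finite_integer_points_bounded[where 'n='n, of "exp L0"] unfolding F_def
    by (intro finite_subset[OF _ finite_Pow_iff[THEN iffD2]]) auto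
  have Fj: "S \<noteq> {}" "finite S" "0 \<notin> S" if "S \<in> F" for S
    using that j(1) by (auto simp: F_def dependent_zero independent_imp_finite)
  define G where "G S = Max (lam ` S)" for S
  have G: "G S \<le> L \<longleftrightarrow> (\<forall>x\<in>S. norm x \<le> exp L \<and> \<bar>x \<bullet> u\<bar> \<le> exp (L - q))" if "S \<in> F" "0 \<le> L" for S L
  proof -
    have "G S \<le> L \<longleftrightarrow> (\<forall>x\<in>S. lam x \<le> L)"
      unfolding G_def using Fj[OF that(1)] by (subst Max_le_iff) auto
    then show ?thesis using lam[OF that(2)] Fj(3)[OF that(1)] by metis
  qed
  have G0: "0 \<le> G S" if "S \<in> F" for S
  proof -
    obtain x where x: "x \<in> S" using Fj(1)[OF \<open>S \<in> F\<close>] by auto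
    have "0 \<le> lam x" by (simp add: lam_def)
    also have "\<dots> \<le> G S" unfolding G_def using x Fj(2)[OF \<open>S \<in> F\<close>] by (intro Max_ge) auto
    finally show ?thesis .
  qed
  have fits: "\<exists>S\<in>F. G S \<le> L" if "fits u j q L" "0 \<le> L" "L \<le> L0" for L
  proof -
    obtain S where S: "card S = j" "independent S" "S \<subseteq> integer_points"
      "\<forall>x\<in>S. norm x \<le> exp L \<and> \<bar>x \<bullet> u\<bar> \<le> exp (L - q)"
      using \<open>fits u j q L\<close> by (auto simp: fits_def)
    have "norm x \<le> exp L0" if "x \<in> S" for x
      using S(4) that \<open>L \<le> L0\<close> by (meson exp_le_cancel_iff order_trans)
    then have "S \<in> F" using S by (auto simp: F_def)
    then show ?thesis using G[of S L] S(4) \<open>0 \<le> L\<close> by blast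
  qed
  have fits': "fits u j q (G S)" if "S \<in> F" for S
    unfolding fits_def using G[OF that G0[OF that]] Fj[OF that] that by (auto simp: F_def)
  have "fits u j q L0"
  proof -
    have "j \<le> card (range (\<lambda>i::'n. axis i (1::real)))"
      using j(2) by (subst card_image) (auto simp: inj_on_def axis_eq_axis)
    then obtain S where S: "S \<subseteq> range (\<lambda>i::'n. axis i (1::real))" "card S = j"
      by (meson obtain_subset_with_card_n)
    have "range (\<lambda>i::'n. axis i (1::real)) \<subseteq> Basis" by (auto simp: Basis_vec_def)
    then have "independent S" using independent_Basis S(1) independent_mono by blast
    moreover have "norm x \<le> exp L0 \<and> \<bar>x \<bullet> u\<bar> \<le> exp (L0 - q)" if "x \<in> S" for x
    proof -
      have "norm x = 1" using that S(1) by auto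
      then have "\<bar>x \<bullet> u\<bar> \<le> 1" using Cauchy_Schwarz_ineq2[of x u] u by simp
      moreover have "1 \<le> exp L0" "1 \<le> exp (L0 - q)" by (auto simp: L0_def)
      ultimately show ?thesis using \<open>norm x = 1\<close> by linarith
    qed
    moreover have "S \<subseteq> integer_points" using S(1) integer_points_axis by auto
    ultimately show ?thesis
      using S(2) unfolding fits_def by (metis independent_imp_finite)
  qed
  moreover have L00: "0 \<le> L0" by (simp add: L0_def)
  ultimately have "F \<noteq> {}" and minL0: "\<exists>S\<in>F. G S \<le> L0" using fits[of L0] by auto
  define L where "L = Min (G ` F)"
  have "L \<in> G ` F" unfolding L_def using finF \<open>F \<noteq> {}\<close> by (intro Min_in) auto
  then obtain S where S: "S \<in> F" "L = G S" by auto
  have Lle: "L \<le> G S'" if "S' \<in> F" for S' unfolding L_def using finF that by (intro Min_le) auto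
  show thesis
  proof (rule that)
    show "0 \<le> L" "fits u j q L" using G0 fits' S by auto
    fix M assume M: "0 \<le> M" "fits u j q M"
    show "L \<le> M"
    proof (cases "M \<le> L0")
      case True
      then show ?thesis using fits[OF M(2,1)] Lle by force
    next
      case False
      then show ?thesis using minL0 Lle by force
    qed
  qed
qed

lemma log_minimum:
  fixes u :: "real^'n::finite"
  assumes "norm u = 1" "1 \<le> j" "j \<le> CARD('n)"
  shows "fits u j q (log_minimum u j q)"
    and "0 \<le> L \<Longrightarrow> fits u j q L \<Longrightarrow> log_minimum u j q \<le> L"
proof -
  obtain M where M: "0 \<le> M" "fits u j q M" "\<And>L. 0 \<le> L \<Longrightarrow> fits u j q L \<Longrightarrow> M \<le> L"
    by (rule ex_least_fit[OF assms, of q]) blast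
  have "log_minimum u j q = M"
    unfolding log_minimum_eq by (rule Least_equality) (use M in auto)
  with M show "fits u j q (log_minimum u j q)"
    "0 \<le> L \<Longrightarrow> fits u j q L \<Longrightarrow> log_minimum u j q \<le> L" by auto
qed

text \<open>Turning the direction by \<eta> changes a product by at most
  \<open>exp L * \<eta>\<close>, the fraction \<open>exp q * \<eta>\<close> of the permitted
  \<open>exp (L - q)\<close>. For fixed \<open>q\<close> this loss vanishes as \<eta> tends to 0,
  which is what the limit of directions needs.\<close>

lemma fits_perturb:
  assumes "fits w j q L" "norm (u - w) \<le> \<eta>"
  shows "fits u j q (L + ln (1 + exp q * \<eta>))"
proof -
  have \<eta>0: "0 \<le> \<eta>" using assms(2) norm_ge_zero order_trans by blast
  have pos: "0 < 1 + exp q * \<eta>" using \<eta>0 by (intro add_pos_nonneg) auto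
  have e: "exp (M + ln (1 + exp q * \<eta>)) = exp M * (1 + exp q * \<eta>)" for M
    using pos by (simp add: exp_add)
  have "norm x \<le> exp (L + ln (1 + exp q * \<eta>)) \<and> \<bar>x \<bullet> u\<bar> \<le> exp (L + ln (1 + exp q * \<eta>) - q)"
    if "norm x \<le> exp L" "\<bar>x \<bullet> w\<bar> \<le> exp (L - q)" for x
  proof
    have "exp L * 1 \<le> exp L * (1 + exp q * \<eta>)" using \<eta>0 by (intro mult_left_mono) auto
    then show "norm x \<le> exp (L + ln (1 + exp q * \<eta>))" using that(1) unfolding e by linarith
    have "\<bar>x \<bullet> u\<bar> \<le> \<bar>x \<bullet> w\<bar> + \<bar>x \<bullet> (u - w)\<bar>" by (simp add: inner_diff_right)
    also have "\<bar>x \<bullet> (u - w)\<bar> \<le> norm x * norm (u - w)" by (rule Cauchy_Schwarz_ineq2)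
    also have "\<dots> \<le> exp L * \<eta>" using that(1) assms(2) by (intro mult_mono) auto
    also have "\<bar>x \<bullet> w\<bar> + exp L * \<eta> \<le> exp (L - q) + exp L * \<eta>" using that(2) by simp
    also have "\<dots> = exp (L - q) * (1 + exp q * \<eta>)"
      by (simp add: exp_diff field_simps)
    also have "\<dots> = exp (L + ln (1 + exp q * \<eta>) - q)"
      using e[of "L - q"] by (simp add: algebra_simps)
    finally show "\<bar>x \<bullet> u\<bar> \<le> exp (L + ln (1 + exp q * \<eta>) - q)" by simp
  qed
  then show ?thesis using assms(1) unfolding fits_def by blast
qed

subsection \<open>The sum of the successive minima\<close>

text \<open>Sets attaining different minima need not be nested, so vectors are picked greedily:
  \<open>Suc m\<close> independent vectors cannot all lie in the span of \<open>m\<close>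
  vectors.\<close>

lemma ex_transversal:
  fixes S :: "nat \<Rightarrow> 'a::euclidean_space set"
  assumes "\<And>j. 1 \<le> j \<Longrightarrow> j \<le> m \<Longrightarrow> card (S j) = j \<and> independent (S j)"
  shows "\<exists>y. (\<forall>j\<in>{1..m}. y j \<in> S j) \<and> inj_on y {1..m} \<and> independent (y ` {1..m})"
  using assms
proof (induction m)
  case 0
  show ?case by (simp add: independent_empty)
next
  case (Suc m)
  have "\<exists>y. (\<forall>j\<in>{1..m}. y j \<in> S j) \<and> inj_on y {1..m} \<and> independent (y ` {1..m})"
    by (rule Suc.IH) (rule Suc.prems, simp_all)
  then obtain y where y: "\<forall>j\<in>{1..m}. y j \<in> S j" "inj_on y {1..m}" "independent (y ` {1..m})"
    by blast
  have Sm: "card (S (Suc m)) = Suc m" "independent (S (Suc m))" using Suc.prems[of "Suc m"] by simp_all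
  have "\<not> S (Suc m) \<subseteq> span (y ` {1..m})"
  proof
    assume sub: "S (Suc m) \<subseteq> span (y ` {1..m})"
    have "card (S (Suc m)) \<le> dim (span (y ` {1..m}))"
      using sub Sm(2) by (rule independent_card_le_dim)
    also have "\<dots> \<le> card (y ` {1..m})" unfolding dim_span by (rule dim_le_card') simp
    also have "\<dots> \<le> m" using card_image_le[of "{1..m}" y] by simp
    finally show False using Sm(1) by simp
  qed
  then obtain z where z: "z \<in> S (Suc m)" "z \<notin> span (y ` {1..m})" by blast
  define y' where "y' = y(Suc m := z)"
  have y': "y' j = y j" if "j \<in> {1..m}" for j using that by (simp add: y'_def)
  have z': "y' (Suc m) = z" by (simp add: y'_def)
  have im: "y' ` {1..m} = y ` {1..m}" using y' by (rule image_cong[OF refl])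
  have ins: "{1..Suc m} = insert (Suc m) {1..m}" by auto
  have "\<forall>j\<in>{1..Suc m}. y' j \<in> S j" unfolding ins using y(1) z(1) y' z' by simp
  moreover have "inj_on y' {1..Suc m}"
  proof -
    have "z \<notin> y ` {1..m}" using z(2) span_base[of z "y ` {1..m}"] by metis
    moreover have "inj_on y' {1..m}" using y(2) inj_on_cong[of "{1..m}" y' y, OF y'] by blast
    ultimately show ?thesis unfolding ins inj_on_insert using im z' by auto
  qed
  moreover have "independent (y' ` {1..Suc m})"
    unfolding ins image_insert im z' using y(3) z(2) by (simp add: independent_insert)
  ultimately show ?case by blast
qed

lemma det_integer_points:
  fixes y :: "'n::finite \<Rightarrow> real^'n"
  assumes "\<And>i. y i \<in> integer_points"
  shows "det (\<chi> i. y i) \<in> \<int>"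
  unfolding det_def using assms
  by (intro Ints_sum Ints_mult Ints_prod) (auto simp: integer_points_def)

lemma det_nonzero_iff_independent:
  fixes y :: "'n::finite \<Rightarrow> real^'n"
  shows "det (\<chi> i. y i) \<noteq> 0 \<longleftrightarrow> inj y \<and> independent (range y)"
proof
  assume det: "det (\<chi> i. y i) \<noteq> 0"
  have "inj y"
  proof (rule injI, rule ccontr)
    fix i j assume "y i = y j" "i \<noteq> j"
    then have "det (\<chi> i. y i) = 0"
      by (intro det_identical_rows[of i j]) (simp_all add: row_def vec_lambda_eta)
    with det show False by contradiction
  qed
  moreover have "rows (\<chi> i. y i) = range y" by (auto simp: rows_def row_def vec_lambda_eta)
  then have "independent (range y)"
    using det det_dependent_rows[of "\<chi> i. y i"] unfolding dependent_vec_eq by metis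
  ultimately show "inj y \<and> independent (range y)" ..
next
  assume y: "inj y \<and> independent (range y)"
  have "c i = 0" if c: "(\<Sum>i\<in>UNIV. c i *\<^sub>R y i) = 0" for c i
  proof -
    have "(\<Sum>v\<in>range y. c (inv y v) *\<^sub>R v) = (\<Sum>i\<in>UNIV. c i *\<^sub>R y i)"
      using y by (simp add: sum.reindex inv_f_f)
    then have "c (inv y (y i)) = 0"
      using y c by (intro independentD[of "range y" "range y" "\<lambda>v. c (inv y v)" "y i"]) simp_all
    then show ?thesis using y by (simp add: inv_f_f)
  qed
  then have "\<exists>B. (\<chi> i. y i) ** B = mat 1"
    unfolding matrix_right_invertible_independent_rows
    by (simp add: row_def vec_lambda_eta scalar_mult_eq_scaleR)
  then have "invertible (\<chi> i. y i)" by (simp add: invertible_right_inverse)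
  then show "det (\<chi> i. y i) \<noteq> 0" by (simp add: invertible_det_nz)
qed

text \<open>Stretching by \<open>exp q\<close> along \<open>u\<close> merges the two size conditions
  into the single bound \<open>2 * exp (L i)\<close> and multiplies the determinant by
  \<open>exp q\<close>. In matrices, \<open>Q\<close> carries an axis to \<open>u\<close> and
  \<open>E\<close> stretches that axis.\<close>

lemma sum_log_sizes:
  fixes y :: "'n::finite \<Rightarrow> real^'n" and u :: "real^'n"
  assumes y: "\<And>i. y i \<in> integer_points" "det (\<chi> i. y i) \<noteq> 0" and u: "norm u = 1" and q: "0 \<le> q"
    and L: "\<And>i. norm (y i) \<le> exp (L i)" "\<And>i. \<bar>y i \<bullet> u\<bar> \<le> exp (L i - q)"
  shows "q \<le> (\<Sum>i\<in>UNIV. L i) + real CARD('n) * ln 2"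
proof -
  obtain k :: 'n where True by simp
  obtain Q where Q: "orthogonal_matrix Q" "Q *v axis k 1 = u"
    using orthogonal_matrix_exists_basis[OF u] by blast
  define E :: "real^'n^'n" where "E = (\<chi> i j. if i = j then if i = k then exp q else 1 else 0)"
  define Y where "Y = (\<chi> i. y i)"
  define r where "r i = transpose Q *v y i" for i
  define r' where "r' i = r i + ((exp q - 1) * (y i \<bullet> u)) *\<^sub>R axis k 1" for i
  have rk: "r i $ k = y i \<bullet> u" for i
  proof -
    have "r i $ k = r i \<bullet> axis k 1" by (simp add: inner_axis)
    also have "\<dots> = y i \<bullet> (Q *v axis k 1)" by (simp add: r_def dot_lmul_matrix flip: vector_transpose_matrix)
    finally show ?thesis by (simp add: Q)
  qed
  have YQ: "Y ** Q = (\<chi> i. r i)"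
    by (simp add: vec_eq_iff Y_def r_def matrix_matrix_mult_def matrix_vector_mult_def transpose_def mult.commute)
  have "(Y ** Q ** E) $ i $ j = r' i $ j" for i j
  proof -
    have "(Y ** Q ** E) $ i $ j = (\<Sum>l\<in>UNIV. r i $ l * E $ l $ j)"
      unfolding YQ by (simp add: matrix_matrix_mult_def)
    also have "\<dots> = (\<Sum>l\<in>UNIV. if l = j then r i $ j * (if j = k then exp q else 1) else 0)"
      by (rule sum.cong) (auto simp: E_def)
    also have "\<dots> = r i $ j * (if j = k then exp q else 1)" by simp
    also have "\<dots> = r' i $ j" by (simp add: r'_def axis_def rk[symmetric] algebra_simps)
    finally show ?thesis .
  qed
  then have YQE: "Y ** Q ** E = (\<chi> i. r' i)" by (simp add: vec_eq_iff)
  have nr: "norm (r' i) \<le> 2 * exp (L i)" for i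
  proof -
    have "orthogonal_transformation ((*v) (transpose Q))"
      using Q(1) by (simp add: orthogonal_transformation_matrix)
    then have "norm (r i) = norm (y i)" unfolding r_def by (rule orthogonal_transformation_norm)
    moreover have "norm (r' i) \<le> norm (r i) + (exp q - 1) * \<bar>y i \<bullet> u\<bar>"
      unfolding r'_def using q by (intro order_trans[OF norm_triangle_ineq]) (simp add: abs_mult norm_axis_1)
    moreover have "(exp q - 1) * \<bar>y i \<bullet> u\<bar> \<le> exp q * exp (L i - q)"
      using L(2)[of i] q by (intro mult_mono) auto
    moreover have "exp q * exp (L i - q) = exp (L i)" by (simp flip: exp_add)
    ultimately show ?thesis using L(1)[of i] by linarith
  qed
  have "det E = exp q"
  proof -
    have "det E = (\<Prod>i\<in>UNIV. E $ i $ i)" by (rule det_diagonal) (simp add: E_def)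
    also have "\<dots> = exp q" by (simp add: E_def prod.remove[of UNIV k])
    finally show ?thesis .
  qed
  moreover have "\<bar>det Q\<bar> = 1" using det_orthogonal_matrix[OF Q(1)] by auto
  ultimately have "\<bar>det (Y ** Q ** E)\<bar> = \<bar>det Y\<bar> * exp q" by (simp add: det_mul abs_mult)
  moreover have "1 \<le> \<bar>det Y\<bar>"
    using det_integer_points[of y] y unfolding Y_def by (metis Ints_nonzero_abs_ge1)
  ultimately have "exp q \<le> \<bar>det (\<chi> i. r' i)\<bar>"
    unfolding YQE using mult_right_mono[of 1 "\<bar>det Y\<bar>" "exp q"] by simp
  also have "\<dots> \<le> (\<Prod>i\<in>UNIV. norm (r' i))" by (rule Hadamard_inequality)
  also have "\<dots> \<le> (\<Prod>i\<in>UNIV. exp (ln 2 + L i))" using nr by (intro prod_mono) (auto simp: exp_add)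
  also have "\<dots> = exp (\<Sum>i\<in>UNIV. ln 2 + L i)" by (simp add: exp_sum)
  finally show ?thesis by (simp add: sum.distrib algebra_simps)
qed

text \<open>The lower estimate of Minkowski's second theorem for these bodies.\<close>

lemma sum_log_minimum:
  fixes u :: "real^'n::finite"
  assumes u: "norm u = 1" and q: "0 \<le> q"
  shows "q \<le> (\<Sum>j=1..CARD('n). log_minimum u j q) + real CARD('n) * ln 2"
proof -
  let ?n = "CARD('n)"
  have "\<forall>j. \<exists>S. 1 \<le> j \<and> j \<le> ?n \<longrightarrow> card S = j \<and> independent S \<and> S \<subseteq> integer_points \<and>
     (\<forall>x\<in>S. norm x \<le> exp (log_minimum u j q) \<and> \<bar>x \<bullet> u\<bar> \<le> exp (log_minimum u j q - q))"
    using log_minimum(1)[OF u] unfolding fits_def by meson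
  then obtain S where S: "\<And>j. 1 \<le> j \<Longrightarrow> j \<le> ?n \<Longrightarrow> card (S j) = j \<and> independent (S j) \<and> S j \<subseteq> integer_points \<and>
     (\<forall>x\<in>S j. norm x \<le> exp (log_minimum u j q) \<and> \<bar>x \<bullet> u\<bar> \<le> exp (log_minimum u j q - q))"
    by metis
  obtain y where y: "\<forall>j\<in>{1..?n}. y j \<in> S j" "inj_on y {1..?n}" "independent (y ` {1..?n})"
    using ex_transversal[of ?n S] S by blast
  obtain f :: "'n \<Rightarrow> nat" where f: "bij_betw f UNIV {1..?n}"
    using finite_same_card_bij[of "UNIV :: 'n set" "{1..?n}"] by auto
  have fr: "f i \<in> {1..?n}" for i using f by (auto simp: bij_betw_def)
  have yf: "y (f i) \<in> S (f i)" for i using y(1) fr by blast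
  have "inj (y \<circ> f)" using f y(2) by (intro comp_inj_on) (auto simp: bij_betw_def)
  moreover have "range (y \<circ> f) = y ` {1..?n}" using f by (metis bij_betw_def image_comp)
  ultimately have "det (\<chi> i. (y \<circ> f) i) \<noteq> 0" using y(3) det_nonzero_iff_independent[of "y \<circ> f"] by simp
  moreover have "(y \<circ> f) i \<in> integer_points" "norm ((y \<circ> f) i) \<le> exp (log_minimum u (f i) q)"
    "\<bar>(y \<circ> f) i \<bullet> u\<bar> \<le> exp (log_minimum u (f i) q - q)" for i
  proof -
    have "1 \<le> f i" "f i \<le> ?n" using fr[of i] by simp_all
    note Si = S[OF this]
    show "(y \<circ> f) i \<in> integer_points" "norm ((y \<circ> f) i) \<le> exp (log_minimum u (f i) q)"
      "\<bar>(y \<circ> f) i \<bullet> u\<bar> \<le> exp (log_minimum u (f i) q - q)"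
      using Si yf[of i] by (simp_all add: subset_iff)
  qed
  ultimately have "q \<le> (\<Sum>i\<in>UNIV. log_minimum u (f i) q) + real CARD('n) * ln 2"
    by (intro sum_log_sizes[OF _ _ u q, of "y \<circ> f"])
  also have "(\<Sum>i\<in>UNIV. log_minimum u (f i) q) = (\<Sum>j=1..?n. log_minimum u j q)"
    using f by (rule sum.reindex_bij_betw)
  finally show ?thesis .
qed

subsection \<open>Local structure of an \<open>(n,0)\<close>-system\<close>

lemma n0_systemD:
  assumes "n0_system n q0 P"
  shows "1 \<le> j \<Longrightarrow> j < n \<Longrightarrow> q0 \<le> q \<Longrightarrow> 0 \<le> P j q"
    and "1 \<le> j \<Longrightarrow> j < n \<Longrightarrow> q0 \<le> q \<Longrightarrow> P j q \<le> P (j + 1) q"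
    and "1 \<le> j \<Longrightarrow> j \<le> n \<Longrightarrow> q0 \<le> q \<Longrightarrow> q \<le> q' \<Longrightarrow> P j q \<le> P j q'"
    and "1 \<le> j \<Longrightarrow> j \<le> n \<Longrightarrow> piecewise_linear_from q0 {0, 1} (psum P j)"
    and "q0 \<le> q \<Longrightarrow> psum P n q = q"
    and "1 \<le> j \<Longrightarrow> j < n \<Longrightarrow> q0 < q \<Longrightarrow> changes_slope (psum P j) 1 0 q \<Longrightarrow> P (j + 1) q \<le> P j q"
  using assms unfolding n0_system_def by blast+

lemma n0_system_sorted:
  assumes sys: "n0_system n q0 P" and "1 \<le> i" "i \<le> j" "j \<le> n" "q0 \<le> q"
  shows "P i q \<le> P j q"
  using assms(3,4)
proof (induction j rule: dec_induct)
  case (step m)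
  then show ?case using n0_systemD(2)[OF sys, of m q] assms(2,5) by force
qed simp

lemma n0_system_nonneg:
  assumes sys: "n0_system n q0 P" and "2 \<le> n" "1 \<le> j" "j \<le> n" "q0 \<le> q"
  shows "0 \<le> P j q"
  using n0_systemD(1)[OF sys, of 1 q] n0_system_sorted[OF sys, of 1 j q] assms by force

lemma psum_step: "P (Suc j) q = psum P (Suc j) q - psum P j q"
  by (simp add: psum_def)

definition rises_on :: "nat \<Rightarrow> (nat \<Rightarrow> real \<Rightarrow> real) \<Rightarrow> nat \<Rightarrow> real \<Rightarrow> real \<Rightarrow> bool" where
  "rises_on n P k a b \<longleftrightarrow> 1 \<le> k \<and> k \<le> n \<and>
     (\<forall>t\<in>{a..b}. \<forall>j. 1 \<le> j \<and> j \<le> n \<longrightarrow>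
        P j t = P j a + (if j = k then t - a else 0) \<and>
        psum P j t = psum P j a + (if k \<le> j then t - a else 0))"

lemma rises_onD:
  assumes "rises_on n P k a b" "a \<le> t" "t \<le> b" "1 \<le> j" "j \<le> n"
  shows "P j t = P j a + (if j = k then t - a else 0)"
    "psum P j t = psum P j a + (if k \<le> j then t - a else 0)"
proof -
  have "t \<in> {a..b}" using assms(2,3) by simp
  then show "P j t = P j a + (if j = k then t - a else 0)"
    "psum P j t = psum P j a + (if k \<le> j then t - a else 0)"
    using assms(1,4,5) unfolding rises_on_def by blast+
qed

text \<open>The slopes of the partial sums are 0 or 1, increase with the index because each
  component is monotone, and end at 1 because \<open>psum P n q = q\<close>. The first index with
  slope 1 is therefore the only rising component.\<close>

lemma rises_on_affine:
  assumes sys: "n0_system n q0 P" and n: "1 \<le> n" and ab: "q0 \<le> a" "a < b"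
    and aff: "\<And>j. 1 \<le> j \<Longrightarrow> j \<le> n \<Longrightarrow>
      \<exists>s\<in>{0, 1}. \<forall>t\<in>{a..b}. psum P j t = psum P j a + s * (t - a)"
  obtains k where "rises_on n P k a b"
proof -
  have "\<forall>j\<in>{1..n}. \<exists>s. s \<in> {0, 1::real} \<and> (\<forall>t\<in>{a..b}. psum P j t = psum P j a + s * (t - a))"
  proof
    fix j assume "j \<in> {1..n}"
    then have "1 \<le> j" "j \<le> n" by simp_all
    from aff[OF this] show "\<exists>s. s \<in> {0, 1::real} \<and> (\<forall>t\<in>{a..b}. psum P j t = psum P j a + s * (t - a))"
      by blast
  qed
  then obtain s where s0: "\<forall>j\<in>{1..n}. s j \<in> {0, 1::real} \<and>
      (\<forall>t\<in>{a..b}. psum P j t = psum P j a + s j * (t - a))"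
    by (rule bchoice[THEN exE])
  have s: "s j \<in> {0, 1}" "t \<in> {a..b} \<Longrightarrow> psum P j t = psum P j a + s j * (t - a)"
    if "1 \<le> j" "j \<le> n" for j t
    using bspec[OF s0, of j] that unfolding atLeastAtMost_iff[of j] by blast+
  have mono: "s j \<le> s (Suc j)" if "1 \<le> j" "Suc j \<le> n" for j
  proof -
    have "P (Suc j) a \<le> P (Suc j) b" using n0_systemD(3)[OF sys, of "Suc j" a b] that ab by simp
    then have "s j * (b - a) \<le> s (Suc j) * (b - a)"
      using s(2)[of j b] s(2)[of "Suc j" b] that ab by (simp add: psum_step[of P])
    then show ?thesis using ab by simp
  qed
  have mono': "s i \<le> s j" if i: "1 \<le> i" and ij: "i \<le> j" "j \<le> n" for i j
    using ij
  proof (induction j rule: dec_induct)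
    case (step m)
    have "s m \<le> s (Suc m)" using step.hyps step.prems i by (intro mono) simp_all
    moreover have "s i \<le> s m" using step.prems by (intro step.IH) simp
    ultimately show ?case by simp
  qed simp
  have "b = a + s n * (b - a)"
    using s(2)[of n b] n ab n0_systemD(5)[OF sys, of a] n0_systemD(5)[OF sys, of b] by simp
  then have "s n * (b - a) = 1 * (b - a)" by (metis add_diff_cancel_left' mult_1)
  then have sn: "s n = 1" using ab by (subst (asm) mult_cancel_right) simp
  define k where "k = (LEAST j. 1 \<le> j \<and> s j = 1)"
  have k: "1 \<le> k \<and> s k = 1" unfolding k_def by (rule LeastI[of "\<lambda>j. 1 \<le> j \<and> s j = 1" n]) (use sn n in simp)
  have kn: "k \<le> n" unfolding k_def by (rule Least_le) (use sn n in simp)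
  have sk: "s j = (if k \<le> j then 1 else 0)" if "1 \<le> j" "j \<le> n" for j
  proof (cases "k \<le> j")
    case True
    then have "s k \<le> s j" using k that by (intro mono') simp_all
    then show ?thesis using k s(1)[OF that] True by auto
  next
    case False
    then have "s j \<noteq> 1" using not_less_Least[of j "\<lambda>j. 1 \<le> j \<and> s j = 1"] that by (auto simp: k_def)
    then show ?thesis using False s(1)[OF that] by auto
  qed
  have ps: "psum P j t = psum P j a + (if k \<le> j then t - a else 0)" if "j \<le> n" "t \<in> {a..b}" for j t
  proof (cases "j = 0")
    case True
    then show ?thesis using k by (simp add: psum_def)
  next
    case False
    then show ?thesis using s(2)[of j t] sk[of j] that by simp
  qed
  have Pj: "P j t = P j a + (if j = k then t - a else 0)" if j: "1 \<le> j" "j \<le> n" "t \<in> {a..b}" for j t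
  proof -
    obtain i where i: "j = Suc i" using j(1) by (cases j) auto
    show ?thesis using ps[of i t] ps[of j t] j unfolding i psum_step[of P] by auto
  qed
  have "rises_on n P k a b"
    unfolding rises_on_def
  proof (intro conjI ballI allI impI)
    fix t j assume t: "t \<in> {a..b}" and j: "1 \<le> j \<and> j \<le> n"
    show "P j t = P j a + (if j = k then t - a else 0)" using j t by (intro Pj) simp_all
    show "psum P j t = psum P j a + (if k \<le> j then t - a else 0)" using j t by (intro ps) simp_all
  qed (use k kn in simp_all)
  then show thesis by (rule that)
qed

lemma finite_isolated:
  fixes q :: real
  assumes "finite B"
  obtains e where "0 < e" "e \<le> 1" "{q<..<q + e} \<inter> B = {}" "{q - e<..<q} \<inter> B = {}"
proof -
  define D where "D = insert 1 ((\<lambda>x. \<bar>x - q\<bar>) ` (B - {q}))"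
  have D: "finite D" "D \<noteq> {}" "\<And>d. d \<in> D \<Longrightarrow> 0 < d" using assms by (auto simp: D_def)
  have le: "Min D \<le> d" if "d \<in> D" for d using D that by simp
  have far: "Min D \<le> \<bar>x - q\<bar>" if "x \<in> B" "x \<noteq> q" for x
    using that by (intro le) (auto simp: D_def)
  show thesis
  proof (rule that[of "Min D"])
    show "0 < Min D" using D by simp
    show "Min D \<le> 1" by (rule le) (simp add: D_def)
    show "{q<..<q + Min D} \<inter> B = {}" "{q - Min D<..<q} \<inter> B = {}"
      using far by (fastforce simp: abs_if)+
  qed
qed

lemma n0_system_local:
  assumes sys: "n0_system n q0 P" and n: "1 \<le> n" and q: "q0 \<le> q"
  obtains e where "0 < e" "\<exists>k. rises_on n P k q (q + e)"
    "q0 < q \<Longrightarrow> q0 \<le> q - e \<and> (\<exists>k. rises_on n P k (q - e) q)"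
proof -
  have "\<forall>j\<in>{1..n}. \<exists>B. finite B \<and>
        (\<forall>x y. q0 \<le> x \<and> x < y \<and> y \<le> q + 1 \<and> {x<..<y} \<inter> B = {} \<longrightarrow>
           (\<exists>s\<in>{0, 1}. \<forall>t\<in>{x..y}. psum P j t = psum P j x + s * (t - x)))"
  proof
    fix j assume "j \<in> {1..n}"
    then have "piecewise_linear_from q0 {0, 1} (psum P j)" by (intro n0_systemD(4)[OF sys]) simp_all
    moreover have "q0 \<le> q + 1" using q by simp
    ultimately show "\<exists>B. finite B \<and>
        (\<forall>x y. q0 \<le> x \<and> x < y \<and> y \<le> q + 1 \<and> {x<..<y} \<inter> B = {} \<longrightarrow>
           (\<exists>s\<in>{0, 1}. \<forall>t\<in>{x..y}. psum P j t = psum P j x + s * (t - x)))"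
      unfolding piecewise_linear_from_def by blast
  qed
  then obtain B where B0: "\<forall>j\<in>{1..n}. finite (B j) \<and>
        (\<forall>x y. q0 \<le> x \<and> x < y \<and> y \<le> q + 1 \<and> {x<..<y} \<inter> B j = {} \<longrightarrow>
           (\<exists>s\<in>{0, 1}. \<forall>t\<in>{x..y}. psum P j t = psum P j x + s * (t - x)))"
    by (rule bchoice[THEN exE])
  have B: "finite (B j)"
    "q0 \<le> x \<Longrightarrow> x < y \<Longrightarrow> y \<le> q + 1 \<Longrightarrow> {x<..<y} \<inter> B j = {} \<Longrightarrow>
       \<exists>s\<in>{0, 1}. \<forall>t\<in>{x..y}. psum P j t = psum P j x + s * (t - x)"
    if "1 \<le> j" "j \<le> n" for j x y
    using bspec[OF B0, of j] that unfolding atLeastAtMost_iff[of j] by blast+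
  obtain e where e: "0 < e" "e \<le> 1" "{q<..<q + e} \<inter> (\<Union>j\<in>{1..n}. B j) = {}"
    "{q - e<..<q} \<inter> (\<Union>j\<in>{1..n}. B j) = {}"
    by (rule finite_isolated[of "\<Union>j\<in>{1..n}. B j" q]) (use B(1) in auto)
  define e' where "e' = (if q0 < q then min e (q - q0) else e)"
  have e': "0 < e'" "e' \<le> e" "q0 < q \<Longrightarrow> q0 \<le> q - e'" using e(1) by (auto simp: e'_def)
  have piece: "\<exists>k. rises_on n P k x y"
    if "q0 \<le> x" "x < y" "y \<le> q + 1" "{x<..<y} \<inter> (\<Union>j\<in>{1..n}. B j) = {}" for x y
  proof -
    have "\<exists>s\<in>{0, 1}. \<forall>t\<in>{x..y}. psum P j t = psum P j x + s * (t - x)" if j: "1 \<le> j" "j \<le> n" for j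
    proof (rule B(2)[OF j \<open>q0 \<le> x\<close> \<open>x < y\<close> \<open>y \<le> q + 1\<close>])
      have "j \<in> {1..n}" using j by simp
      then show "{x<..<y} \<inter> B j = {}" using \<open>{x<..<y} \<inter> (\<Union>j\<in>{1..n}. B j) = {}\<close> by blast
    qed
    from rises_on_affine[OF sys n \<open>q0 \<le> x\<close> \<open>x < y\<close> this] show ?thesis by blast
  qed
  show thesis
  proof (rule that[OF e'(1)])
    have "{q<..<q + e'} \<subseteq> {q<..<q + e}" using e'(2) by auto
    then show "\<exists>k. rises_on n P k q (q + e')" using e' e(2,3) q by (intro piece) auto
    assume "q0 < q"
    have "{q - e'<..<q} \<subseteq> {q - e<..<q}" using e'(2) by auto
    then have "\<exists>k. rises_on n P k (q - e') q" using e' e(4) \<open>q0 < q\<close> by (intro piece) auto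
    then show "q0 \<le> q - e' \<and> (\<exists>k. rises_on n P k (q - e') q)" using e'(3) \<open>q0 < q\<close> by simp
  qed
qed

lemma psum_changes_slope:
  assumes l: "rises_on n P k0 a q" "a < q" and r: "rises_on n P k1 q b" "q < b"
    and j: "k0 \<le> j" "j < k1" "1 \<le> j" "j \<le> n"
  shows "changes_slope (psum P j) 1 0 q"
  unfolding changes_slope_def
proof
  have *: "psum P j a + (t - a) = psum P j t" if "a \<le> t" "t \<le> q" for t
    using rises_onD(2)[OF l(1), of t j] that j by simp
  have "((\<lambda>t. psum P j a + (t - a)) has_real_derivative 1) (at_left q)"
    by (auto intro!: derivative_eq_intros)
  moreover have ev: "\<forall>\<^sub>F t in at_left q. psum P j a + (t - a) = psum P j t"
    unfolding eventually_at_left[OF l(2)]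
    by (intro exI[of _ a] conjI allI impI l(2)) (rule *, simp_all)
  have "psum P j a + (q - a) = psum P j q" by (rule *) (use l(2) in simp_all)
  note has_field_derivative_cong_eventually[OF ev this]
  ultimately show "(psum P j has_real_derivative 1) (at_left q)" by blast
  have **: "psum P j q = psum P j t" if "q \<le> t" "t \<le> b" for t
    using rises_onD(2)[OF r(1), of t j] that j by simp
  have "((\<lambda>t. psum P j q) has_real_derivative 0) (at_right q)" by simp
  moreover have ev: "\<forall>\<^sub>F t in at_right q. psum P j q = psum P j t"
    unfolding eventually_at_right[OF r(2)]
    by (intro exI[of _ b] conjI allI impI r(2)) (rule **, simp_all)
  note has_field_derivative_cong_eventually[OF ev refl]
  ultimately show "(psum P j has_real_derivative 0) (at_right q)" by blast
qed

text \<open>The only use of (S5).\<close>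

lemma rises_on_drop:
  assumes sys: "n0_system n q0 P" and q: "q0 < q"
    and l: "rises_on n P k0 a q" "a < q" and r: "rises_on n P k1 q b" "q < b"
  shows "P k1 q \<le> P k0 q"
proof -
  have k: "1 \<le> k0" "k0 \<le> n" "1 \<le> k1" "k1 \<le> n" using l(1) r(1) by (auto simp: rises_on_def)
  show ?thesis
  proof (cases "k1 \<le> k0")
    case True
    then show ?thesis using n0_system_sorted[OF sys, of k1 k0 q] k q by simp
  next
    case False
    \<comment> \<open>Every partial sum between \<open>k0\<close> and \<open>k1\<close> turns from
      slope 1 to slope 0 at \<open>q\<close>, so the inequalities chain up.\<close>
    have "P j q \<le> P k0 q" if le: "k0 \<le> j" "j \<le> k1" for j
      using le
    proof (induction j rule: dec_induct)
      case (step m)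
      have "changes_slope (psum P m) 1 0 q"
        using step k by (intro psum_changes_slope[OF l r]) auto
      then have "P (m + 1) q \<le> P m q" using n0_systemD(6)[OF sys, of m q] step k q by simp
      then show ?case using step by simp
    qed simp
    then show ?thesis using False by simp
  qed
qed

subsection \<open>Following the system\<close>

text \<open>Adding 1 keeps clear of cell 0 and makes the rounding upward, so that the cells of all
  components add up to at least \<open>q\<close>, as \<open>cell_state_bounds\<close>
  requires.\<close>

definition level :: "nat \<Rightarrow> real \<Rightarrow> nat" where
  "level n p = nat \<lfloor>p / width n\<rfloor> + 1"

lemma level_bounds:
  assumes "0 < width n" "0 \<le> p"
  shows "1 \<le> level n p" "p < real (level n p) * width n" "real (level n p) * width n \<le> p + width n"
proof -
  define r where "r = p / width n"
  have "0 \<le> r" using assms by (simp add: r_def)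
  then have lv: "real (level n p) = of_int \<lfloor>r\<rfloor> + 1" by (simp add: level_def r_def)
  have p: "p = r * width n" using assms by (simp add: r_def)
  show "1 \<le> level n p" by (simp add: level_def)
  have "r < real (level n p)" "real (level n p) \<le> r + 1" unfolding lv by linarith+
  then show "p < real (level n p) * width n" "real (level n p) * width n \<le> p + width n"
    using mult_strict_right_mono[of r "real (level n p)" "width n"]
      mult_right_mono[of "real (level n p)" "r + 1" "width n"] assms(1)
    by (auto simp: p algebra_simps)
qed

lemma level_mono:
  assumes "0 < width n" "p \<le> p'"
  shows "level n p \<le> level n p'"
  using assms unfolding level_def by (intro add_right_mono nat_mono floor_mono divide_right_mono) auto

lemma level_add_le:
  assumes "0 < width n" "0 \<le> p" "p' < p + width n"
  shows "level n p' \<le> level n p + 1"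
proof (cases "0 \<le> p'")
  case True
  have "p' < (real (level n p) + 1) * width n"
    using level_bounds(2)[OF assms(1,2)] assms(3) by (simp add: algebra_simps)
  moreover have "real (level n p') * width n \<le> p' + width n" by (rule level_bounds(3)[OF assms(1) True])
  ultimately have "real (level n p') * width n < (real (level n p) + 2) * width n"
    by (simp add: algebra_simps)
  then have "real (level n p') < real (level n p) + 2" using assms(1) by simp
  then show ?thesis by linarith
next
  case False
  then show ?thesis using level_mono[OF assms(1), of p' p] assms(2) by simp
qed

text \<open>Cells are closed below and open above, so levels stay constant for a while after each
  time. A state thus persists to the right, and changes are due only on arrival from the
  left.\<close>

lemma level_eqI:
  assumes "0 < width n" "0 \<le> p" "p \<le> p'" "p' < real (level n p) * width n"
  shows "level n p' = level n p"
proof (rule antisym)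
  have "real (level n p') * width n \<le> p' + width n" using assms by (intro level_bounds(3)) auto
  then have "real (level n p') * width n < (real (level n p) + 1) * width n"
    using assms(4) by (simp add: algebra_simps)
  then have "real (level n p') < real (level n p) + 1" using assms(1) by simp
  then show "level n p' \<le> level n p" by linarith
qed (rule level_mono[OF assms(1,3)])

text \<open>One width for rounding up, one for the extent of the cell, and the logarithm of the
  constant in \<open>cell_state_bounds\<close>.\<close>

definition tolerance :: "nat \<Rightarrow> real" where
  "tolerance n = 2 * width n + ln (8 * 12 ^ n)"

lemma tolerance_nonneg: "0 \<le> tolerance CARD('n::finite)"
  using width_pos[where 'n='n] unfolding tolerance_def
  by (intro add_nonneg_nonneg ln_ge_zero) (auto intro: order_trans[of _ "8 * 1"])

text \<open>The \<open>j\<close> vectors attached by \<sigma> to the components 1 to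
  \<open>j\<close> serve as witnesses; as the components are sorted, \<open>P j q\<close> bounds all
  their sizes.\<close>

lemma cell_state_fits:
  fixes x :: "'n::finite \<Rightarrow> real^'n"
  assumes sys: "n0_system CARD('n) q0 P" and n: "2 \<le> CARD('n)"
    and cs: "cell_state x k A u c" and \<sigma>: "bij_betw \<sigma> UNIV {1..CARD('n)}"
    and c: "\<And>i. c i = level CARD('n) (P (\<sigma> i) q)" and q: "q0 \<le> q"
    and w: "norm (w - u) \<le> radius k A c" and j: "1 \<le> j" "j \<le> CARD('n)"
  shows "fits w j q (P j q + tolerance CARD('n))"
proof -
  define n where "n = CARD('n)"
  define h where "h = width n"
  have h0: "0 < width n" using width_pos[where 'n='n] by (simp add: n_def)
  have \<sigma>r: "1 \<le> \<sigma> i" "\<sigma> i \<le> n" for i using \<sigma> by (auto simp: bij_betw_def n_def)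
  have P0: "0 \<le> P (\<sigma> i) q" for i
    using n0_system_nonneg[OF sys n] \<sigma>r q by (simp add: n_def)
  note lev = level_bounds[OF h0 P0]
  have c1: "1 \<le> c i" for i using lev(1) c by (simp add: n_def)
  have "q = (\<Sum>j=1..n. P j q)" using n0_systemD(5)[OF sys q] by (simp add: psum_def n_def)
  also have "\<dots> = (\<Sum>i\<in>UNIV. P (\<sigma> i) q)"
    using sum.reindex_bij_betw[OF \<sigma>, of "\<lambda>j. P j q"] by (simp add: n_def)
  also have "\<dots> \<le> (\<Sum>i\<in>UNIV. real (c i) * width n)"
    using lev(2) c by (intro sum_mono) (simp add: n_def less_imp_le)
  finally have qle: "q \<le> (\<Sum>i\<in>UNIV. real (c i) * width CARD('n))" by (simp add: n_def)
  note bounds = cell_state_bounds[OF cs c1 qle w]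
  define I where "I = {i. \<sigma> i \<le> j}"
  have inj\<sigma>: "inj \<sigma>" using \<sigma> by (simp add: bij_betw_def)
  have "\<sigma> ` I = {1..j}"
  proof
    show "\<sigma> ` I \<subseteq> {1..j}" using \<sigma>r by (auto simp: I_def)
    show "{1..j} \<subseteq> \<sigma> ` I"
    proof
      fix l assume l: "l \<in> {1..j}"
      then have "l \<in> range \<sigma>" using \<sigma> j by (auto simp: bij_betw_def)
      then show "l \<in> \<sigma> ` I" using l by (auto simp: I_def)
    qed
  qed
  then have cardI: "card I = j" using card_image[of \<sigma> I] inj\<sigma> by (simp add: inj_on_subset)
  have "det (\<chi> i. x i) \<noteq> 0" using cs by (simp add: cell_state_def reduced_basis_def)
  then have x: "inj x" "independent (range x)" by (auto simp: det_nonzero_iff_independent)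
  show ?thesis
    unfolding fits_def
  proof (intro exI[of _ "x ` I"] conjI ballI)
    show "finite (x ` I)" by simp
    show "card (x ` I) = j" using cardI x(1) by (simp add: card_image inj_on_subset)
    show "independent (x ` I)" using x(2) by (rule independent_mono) auto
    show "x ` I \<subseteq> integer_points" using cs by (auto simp: cell_state_def reduced_basis_def)
    fix v assume "v \<in> x ` I"
    then obtain i where i: "v = x i" "\<sigma> i \<le> j" by (auto simp: I_def)
    have "P (\<sigma> i) q \<le> P j q" using n0_system_sorted[OF sys] \<sigma>r i(2) j q by simp
    then have "(real (c i) + 1) * width CARD('n) \<le> P j q + 2 * width CARD('n)"
      using lev(3)[of i] c[of i] by (simp add: n_def algebra_simps)
    moreover have "8 * 12 ^ CARD('n) * exp r = exp (r + ln (8 * 12 ^ CARD('n)))" for r :: real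
      by (simp add: exp_add)
    ultimately have le: "8 * 12 ^ CARD('n) * exp ((real (c i) + 1) * width CARD('n) - r)
        \<le> exp (P j q + tolerance CARD('n) - r)" for r
      by (simp add: tolerance_def)
    show "norm v \<le> exp (P j q + tolerance CARD('n))"
      using order_trans[OF bounds(1)[of i]] le[of 0] by (simp add: i(1))
    show "\<bar>v \<bullet> w\<bar> \<le> exp (P j q + tolerance CARD('n) - q)"
      using order_trans[OF bounds(2)[of i]] le[of q] by (simp add: i(1))
  qed
qed

text \<open>
  The condition on \<open>level CARD('n) (P j q)\<close> concerns the component that starts rising at
  \<open>q\<close>; it guarantees that the next vector to be replaced is shorter than the one just
  inserted.
\<close>

definition follows ::
    "(nat \<Rightarrow> real \<Rightarrow> real) \<Rightarrow> real \<Rightarrow> real \<Rightarrow> ('n::finite \<Rightarrow> nat) \<Rightarrow> ('n \<Rightarrow> real^'n) \<Rightarrow> 'n \<Rightarrow>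
     ('n \<Rightarrow> real) \<Rightarrow> real^'n \<Rightarrow> ('n \<Rightarrow> nat) \<Rightarrow> bool" where
  "follows P q0 q \<sigma> x k A u c \<longleftrightarrow> bij_betw \<sigma> UNIV {1..CARD('n)} \<and> cell_state x k A u c \<and>
     (\<forall>i. c i = level CARD('n) (P (\<sigma> i) q)) \<and>
     (\<forall>j. 1 \<le> j \<and> j \<le> CARD('n) \<and> (\<forall>t>q. P j q < P j t) \<longrightarrow> level CARD('n) (P j q) \<le> c k) \<and>
     (\<forall>w. norm (w - u) \<le> radius k A c \<longrightarrow>
        (\<forall>t\<in>{q0..q}. \<forall>j. 1 \<le> j \<and> j \<le> CARD('n) \<longrightarrow> fits w j t (P j t + tolerance CARD('n))))"

definition followed :: "'n::finite itself \<Rightarrow> (nat \<Rightarrow> real \<Rightarrow> real) \<Rightarrow> real \<Rightarrow> real \<Rightarrow> bool" where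
  "followed _ P q0 q \<longleftrightarrow>
     (\<exists>\<sigma> x k A u c. follows P q0 q (\<sigma> :: 'n \<Rightarrow> nat) x k A u c)"

section \<open>Propagation of the invariant in time\<close>

lemma followed_start:
  assumes sys: "n0_system CARD('n::finite) q0 P" and n: "2 \<le> CARD('n)"
  shows "followed TYPE('n) P q0 q0"
proof -
  obtain \<sigma> :: "'n \<Rightarrow> nat" where \<sigma>: "bij_betw \<sigma> UNIV {1..CARD('n)}"
    using finite_same_card_bij[of "UNIV :: 'n set" "{1..CARD('n)}"] by auto
  \<comment> \<open>Giving the largest component to the distinguished index ensures the level
    condition, whichever component rises first.\<close>
  have "CARD('n) \<in> range \<sigma>" using \<sigma> n by (auto simp: bij_betw_def)
  then obtain k where k: "\<sigma> k = CARD('n)" by auto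
  define c where "c i = level CARD('n) (P (\<sigma> i) q0)" for i
  have "1 \<le> c i" for i by (simp add: c_def level_def)
  then obtain x A u where cs: "cell_state x k A u c" using cell_state_exists[of c k] by blast
  have "level CARD('n) (P j q0) \<le> c k" if "1 \<le> j" "j \<le> CARD('n)" for j
    unfolding c_def k using that by (intro level_mono width_pos n0_system_sorted[OF sys]) auto
  moreover have "fits w j t (P j t + tolerance CARD('n))"
    if "norm (w - u) \<le> radius k A c" "t \<in> {q0..q0}" "1 \<le> j" "j \<le> CARD('n)" for w t j
    using that by (intro cell_state_fits[OF sys n cs \<sigma>]) (auto simp: c_def)
  ultimately have "follows P q0 q0 \<sigma> x k A u c"
    unfolding follows_def using \<sigma> cs by (auto simp: c_def)
  then show ?thesis unfolding followed_def by blast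
qed

lemma rises_on_increasing:
  assumes sys: "n0_system n q0 P" and r: "rises_on n P k a b" "a < b" and q: "q0 \<le> a" "a \<le> q" "q < b" "q < t"
  shows "P k q < P k t"
proof -
  have k: "1 \<le> k" "k \<le> n" using r by (auto simp: rises_on_def)
  have "P k q < P k (min t b)"
    using rises_onD(1)[OF r(1), of q k] rises_onD(1)[OF r(1), of "min t b" k] k q by simp
  also have "\<dots> \<le> P k t" using n0_systemD(3)[OF sys, of k "min t b" t] k q by simp
  finally show ?thesis .
qed

lemma follows_right:
  fixes \<sigma> :: "'n::finite \<Rightarrow> nat"
  assumes sys: "n0_system CARD('n) q0 P" and n: "2 \<le> CARD('n)" and q: "q0 \<le> q"
    and fol: "follows P q0 q \<sigma> x k A u c"
  obtains e where "0 < e" "\<And>t. q \<le> t \<Longrightarrow> t \<le> q + e \<Longrightarrow> follows P q0 t \<sigma> x k A u c"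
proof -
  define n where "n = CARD('n)"
  have h0: "0 < width n" using width_pos[where 'n='n] by (simp add: n_def)
  obtain e0 k1 where e0: "0 < e0" "rises_on n P k1 q (q + e0)"
    using n0_system_local[OF sys _ q] n unfolding n_def
    by (metis one_le_numeral order_trans)
  have k1: "1 \<le> k1" "k1 \<le> n" using e0 by (auto simp: rises_on_def)
  have P0: "0 \<le> P j q" if "1 \<le> j" "j \<le> n" for j
    using n0_system_nonneg[OF sys n] that q by (simp add: n_def)
  define g where "g = real (level n (P k1 q)) * width n - P k1 q"
  have g0: "0 < g" using level_bounds(2)[OF h0 P0[OF k1]] by (simp add: g_def)
  define e where "e = min e0 g / 2"
  have e: "0 < e" "e < e0" "e < g" using e0(1) g0 by (auto simp: e_def min_def)
  have lev: "level n (P j t) = level n (P j q)" if "1 \<le> j" "j \<le> n" "q \<le> t" "t \<le> q + e" for j t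
  proof (cases "j = k1")
    case True
    have "P k1 t = P k1 q + (t - q)" using rises_onD(1)[OF e0(2), of t k1] that e k1 by simp
    then show ?thesis unfolding True
      using that e by (intro level_eqI h0 P0 k1) (auto simp: g_def)
  next
    case False
    then show ?thesis using rises_onD(1)[OF e0(2), of t j] that e by simp
  qed
  have \<sigma>: "bij_betw \<sigma> UNIV {1..n}" and cs: "cell_state x k A u c"
    and c: "\<And>i. c i = level n (P (\<sigma> i) q)"
    and ck: "\<And>j. 1 \<le> j \<Longrightarrow> j \<le> n \<Longrightarrow> (\<forall>t>q. P j q < P j t) \<Longrightarrow> level n (P j q) \<le> c k"
    and past: "\<And>w t j. norm (w - u) \<le> radius k A c \<Longrightarrow> t \<in> {q0..q} \<Longrightarrow> 1 \<le> j \<Longrightarrow> j \<le> n \<Longrightarrow>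
      fits w j t (P j t + tolerance n)"
    using fol unfolding follows_def n_def by blast+
  have \<sigma>r: "1 \<le> \<sigma> i" "\<sigma> i \<le> n" for i using \<sigma> by (auto simp: bij_betw_def)
  have ct: "c i = level n (P (\<sigma> i) t)" if "q \<le> t" "t \<le> q + e" for i t
    using c lev[OF \<sigma>r that] by simp
  show thesis
  proof (rule that[OF e(1)])
    fix t assume t: "q \<le> t" "t \<le> q + e"
    have "level n (P j t) \<le> c k" if j: "1 \<le> j" "j \<le> n" "\<forall>s>t. P j t < P j s" for j
    proof -
      have "P j t < P j (q + e0)" using j(3) t e by simp
      then have "j = k1"
        using rises_onD(1)[OF e0(2), of t j] rises_onD(1)[OF e0(2), of "q + e0" j] j t e
        by (auto split: if_splits)
      moreover have "level n (P k1 q) \<le> c k"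
        using e0 q by (intro ck k1 allI impI rises_on_increasing[OF sys[folded n_def] e0(2)]) auto
      ultimately show ?thesis using lev[OF j(1,2) t] by simp
    qed
    moreover have "fits w j s (P j s + tolerance n)"
      if "norm (w - u) \<le> radius k A c" "s \<in> {q0..t}" "1 \<le> j" "j \<le> n" for w s j
    proof (cases "s \<le> q")
      case True
      then show ?thesis using past that by simp
    next
      case False
      then show ?thesis unfolding n_def
        using that t ct \<sigma> by (intro cell_state_fits[OF sys n cs]) (auto simp: n_def)
    qed
    ultimately show "follows P q0 t \<sigma> x k A u c"
      unfolding follows_def n_def[symmetric] using \<sigma> cs ct[OF t] by blast
  qed
qed

text \<open>On a short interval ending at \<open>q\<close> only \<open>k0\<close> rises, and it
  enters at most one new cell. If it does, its vector must be the distinguished one. Should its old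
  cell equal that of \<open>k\<close>, an exchange of labels suffices; otherwise it is lower, and a
  switch is possible.\<close>

lemma followed_left:
  assumes sys: "n0_system CARD('n::finite) q0 P" and n: "2 \<le> CARD('n)" and q: "q0 < q"
    and prev: "\<And>t. q0 \<le> t \<Longrightarrow> t < q \<Longrightarrow> followed TYPE('n) P q0 t"
  shows "followed TYPE('n) P q0 q"
proof -
  define n where "n = CARD('n)"
  have sysn: "n0_system n q0 P" using sys by (simp add: n_def)
  have h0: "0 < width n" using width_pos[where 'n='n] by (simp add: n_def)
  obtain e0 where "0 < e0" and ex1: "\<exists>k. rises_on n P k q (q + e0)"
    and ex0: "q0 < q \<Longrightarrow> q0 \<le> q - e0 \<and> (\<exists>k. rises_on n P k (q - e0) q)"
    by (rule n0_system_local[OF sysn, of q]) (use n q in \<open>auto simp: n_def\<close>)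
  obtain k1 where r: "rises_on n P k1 q (q + e0)" using ex1 by blast
  obtain k0 where l: "rises_on n P k0 (q - e0) q" and e0q: "q0 \<le> q - e0" using ex0 q by blast
  have k0: "1 \<le> k0" "k0 \<le> n" using l by (auto simp: rises_on_def)
  have k1: "1 \<le> k1" "k1 \<le> n" using r by (auto simp: rises_on_def)
  define t where "t = q - min e0 (width n) / 2"
  have t: "q0 \<le> t" "t < q" "q - e0 < t" "q < t + width n"
    using \<open>0 < e0\<close> h0 e0q by (auto simp: t_def min_def)
  have P0: "0 \<le> P j s" if "1 \<le> j" "j \<le> n" "q0 \<le> s" for j s
    using n0_system_nonneg[OF sys n] that by (simp add: n_def)
  have Ps: "P j s = P j t + (if j = k0 then s - t else 0)" if "1 \<le> j" "j \<le> n" "t \<le> s" "s \<le> q" for j s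
    using rises_onD(1)[OF l, of s j] rises_onD(1)[OF l, of t j] that t by auto
  obtain \<sigma> :: "'n \<Rightarrow> nat" and x k A u c where fol: "follows P q0 t \<sigma> x k A u c"
    using prev[OF t(1,2)] unfolding followed_def by blast
  have \<sigma>: "bij_betw \<sigma> UNIV {1..n}" and cs: "cell_state x k A u c"
    and c: "\<And>i. c i = level n (P (\<sigma> i) t)"
    and ck: "\<And>j. 1 \<le> j \<Longrightarrow> j \<le> n \<Longrightarrow> (\<forall>s>t. P j t < P j s) \<Longrightarrow> level n (P j t) \<le> c k"
    and past: "\<And>w s j. norm (w - u) \<le> radius k A c \<Longrightarrow> s \<in> {q0..t} \<Longrightarrow> 1 \<le> j \<Longrightarrow> j \<le> n \<Longrightarrow>
      fits w j s (P j s + tolerance n)"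
    using fol unfolding follows_def n_def by blast+
  have \<sigma>r: "1 \<le> \<sigma> i" "\<sigma> i \<le> n" for i using \<sigma> by (auto simp: bij_betw_def)
  define m where "m = level n (P k0 t)"
  have mk: "m \<le> c k"
    unfolding m_def using t e0q \<open>0 < e0\<close>
    by (intro ck k0 allI impI rises_on_increasing[OF sysn l]) auto
  define m' where "m' = level n (P k0 q)"
  have lev: "level n (P k0 s) = m \<or> level n (P k0 s) = m'" if "t \<le> s" "s \<le> q" for s
  proof -
    have "m \<le> level n (P k0 s)" "level n (P k0 s) \<le> m'"
      unfolding m_def m'_def using that t k0
      by (auto intro!: level_mono[OF h0] n0_systemD(3)[OF sysn])
    moreover have "m' \<le> m + 1"
      unfolding m_def m'_def using t k0 Ps[OF k0, of q] by (intro level_add_le h0 P0) auto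
    ultimately show ?thesis by linarith
  qed
  \<comment> \<open>By (S5) the component that starts at \<open>q\<close> is not above the one that
    rose before; this restores the level condition at \<open>q\<close>.\<close>
  have k1q: "level n (P j q) \<le> m'" if j: "1 \<le> j" "j \<le> n" "\<forall>s>q. P j q < P j s" for j
  proof -
    have "P j q < P j (q + e0)" using j(3) \<open>0 < e0\<close> by simp
    then have "j = k1" using rises_onD(1)[OF r, of "q + e0" j] j \<open>0 < e0\<close> by (auto split: if_splits)
    moreover have "P k1 q \<le> P k0 q"
      by (rule rises_on_drop[OF sysn q l _ r]) (use \<open>0 < e0\<close> in auto)
    ultimately show ?thesis unfolding m'_def by (intro level_mono[OF h0]) simp
  qed
  have old: "fits w j s (P j s + tolerance n)"
    if w: "norm (w - u) \<le> radius k A c" and s: "q0 \<le> s" "s \<le> q" "t \<le> s \<Longrightarrow> level n (P k0 s) = m"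
      and j: "1 \<le> j" "j \<le> n" for w s j
  proof (cases "s \<le> t")
    case True
    then show ?thesis using past w s j by simp
  next
    case False
    have "c i = level n (P (\<sigma> i) s)" for i
      using c[of i] Ps[OF \<sigma>r, of s i] False s by (cases "\<sigma> i = k0") (auto simp: m_def)
    then show ?thesis unfolding n_def
      using w s j \<sigma> by (intro cell_state_fits[OF sys n cs]) (auto simp: n_def)
  qed
  show ?thesis
  proof (cases "m' = m")
    case True
    have "c i = level n (P (\<sigma> i) q)" for i
      using c[of i] Ps[OF \<sigma>r, of q i] t True by (cases "\<sigma> i = k0") (auto simp: m_def m'_def)
    moreover have "fits w j s (P j s + tolerance n)"
      if "norm (w - u) \<le> radius k A c" "s \<in> {q0..q}" "1 \<le> j" "j \<le> n" for w s j
      using that lev True by (intro old) auto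
    moreover have "level n (P j q) \<le> c k" if "1 \<le> j" "j \<le> n" "\<forall>s>q. P j q < P j s" for j
      using k1q[OF that] mk True by simp
    ultimately have "follows P q0 q \<sigma> x k A u c"
      unfolding follows_def n_def[symmetric] using \<sigma> cs by blast
    then show ?thesis unfolding followed_def by blast
  next
    case False
    then have m': "m' = m + 1"
      using lev[of q] level_add_le[OF h0 P0[OF k0 t(1)], of "P k0 q"] level_mono[OF h0, of "P k0 t" "P k0 q"]
        n0_systemD(3)[OF sysn k0 t(1)] t Ps[OF k0, of q] unfolding m_def m'_def by force
    \<comment> \<open>The common end of both cases. Before the crossing the old state gives the
      bounds; the new ball lies in the old one, so they hold for all \<open>w\<close> near
      \<open>u'\<close> too.\<close>
    have new: "followed TYPE('n) P q0 q"
      if \<sigma>': "bij_betw \<sigma>' UNIV {1..n}" and cs': "cell_state x' k' A' u' (b(k' := Suc m))"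
        and b: "\<And>i. b i = level n (P (\<sigma>' i) t)" and k': "\<sigma>' k' = k0"
        and sub: "norm (u' - u) + radius k' A' (b(k' := Suc m)) \<le> radius k A c"
      for \<sigma>' :: "'n \<Rightarrow> nat" and x' k' A' u' b
    proof -
      define c' where "c' = b(k' := Suc m)"
      have \<sigma>'r: "1 \<le> \<sigma>' i" "\<sigma>' i \<le> n" for i using \<sigma>' by (auto simp: bij_betw_def)
      have \<sigma>'k: "\<sigma>' i \<noteq> k0" if "i \<noteq> k'" for i
        using \<sigma>' k' that by (metis UNIV_I bij_betw_inv_into_left)
      have c': "c' i = level n (P (\<sigma>' i) s)" if "t \<le> s" "s \<le> q" "level n (P k0 s) = m'" for i s
        using b[of i] Ps[OF \<sigma>'r, of s i] that \<sigma>'k[of i] m' by (cases "i = k'") (auto simp: c'_def k')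
      have "fits w j s (P j s + tolerance n)"
        if w: "norm (w - u') \<le> radius k' A' c'" and s: "s \<in> {q0..q}" and j: "1 \<le> j" "j \<le> n" for w s j
      proof (cases "t \<le> s \<and> level n (P k0 s) = m'")
        case True
        then have "c' i = level CARD('n) (P (\<sigma>' i) s)" for i using c'[of s i] s by (simp add: n_def)
        then show ?thesis unfolding n_def using w s j
          by (intro cell_state_fits[OF sys n cs'[folded c'_def] \<sigma>'[unfolded n_def]]) (simp_all add: n_def)
      next
        case False
        have "norm (w - u) \<le> norm (w - u') + norm (u' - u)"
          using norm_triangle_ineq[of "w - u'" "u' - u"] by simp
        then have "norm (w - u) \<le> radius k A c" using w sub by (simp add: c'_def)
        then show ?thesis using False s lev by (intro old j) auto
      qed
      moreover have "level n (P j q) \<le> c' k'" if "1 \<le> j" "j \<le> n" "\<forall>s>q. P j q < P j s" for j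
        using k1q[OF that] m' by (simp add: c'_def)
      moreover have "c' i = level n (P (\<sigma>' i) q)" for i
        using t by (intro c') (auto simp: m'_def)
      ultimately have "follows P q0 q \<sigma>' x' k' A' u' c'"
        unfolding follows_def n_def[symmetric] using \<sigma>' cs' by (auto simp: c'_def)
      then show ?thesis unfolding followed_def by blast
    qed
    have "k0 \<in> range \<sigma>" using \<sigma> k0 by (auto simp: bij_betw_def)
    then obtain i0 where i0: "\<sigma> i0 = k0" by auto
    have ci0: "c i0 = m" by (simp add: c i0 m_def)
    show ?thesis
    proof (cases "m = c k")
      case True
      \<comment> \<open>The components carried by \<open>k\<close> and \<open>i0\<close> have equal
        level, so interchanging them leaves all cells unchanged.\<close>
      define \<sigma>' where "\<sigma>' = \<sigma> \<circ> Transposition.transpose k i0"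
      have "bij_betw \<sigma>' UNIV {1..n}"
        unfolding \<sigma>'_def using \<sigma> by (intro bij_betw_trans[of _ UNIV UNIV]) auto
      moreover have "c i = level n (P (\<sigma>' i) t)" for i
        using c[of k] c[of i0] c[of i] ci0 True
        by (auto simp: \<sigma>'_def Transposition.transpose_def)
      moreover have "\<sigma>' k = k0" by (simp add: \<sigma>'_def i0)
      ultimately show ?thesis
        using cell_state_advance[OF cs] True by (intro new[of \<sigma>' x k A u c]) auto
    next
      case False
      then have lt: "c i0 < c k" and ne: "i0 \<noteq> k" using mk ci0 by auto
      obtain x' A' u' where "cell_state x' i0 A' u' (c(i0 := Suc m))"
        "norm (u' - u) + radius i0 A' (c(i0 := Suc m)) \<le> radius k A c"
        by (rule cell_state_switch[OF cs ne lt, of "Suc m"]) (use ci0 in auto)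
      then show ?thesis using \<sigma> c i0 by (intro new[of \<sigma> x' i0 A' u' c])
    qed
  qed
qed

text \<open>Real induction: \<open>followed_left\<close> reaches the infimum of the failing times,
  and \<open>follows_right\<close> passes it.\<close>

lemma followed_all:
  assumes sys: "n0_system CARD('n::finite) q0 P" and n: "2 \<le> CARD('n)" and q: "q0 \<le> q"
  shows "followed TYPE('n) P q0 q"
proof (rule ccontr)
  assume not: "\<not> followed TYPE('n) P q0 q"
  define B where "B = {t. q0 \<le> t \<and> \<not> followed TYPE('n) P q0 t}"
  have B: "B \<noteq> {}" "bdd_below B" using not q by (auto simp: B_def bdd_below_def)
  define s where "s = Inf B"
  have s: "q0 \<le> s" unfolding s_def using B(1) by (intro cInf_greatest) (auto simp: B_def)
  have below: "followed TYPE('n) P q0 t" if "q0 \<le> t" "t < s" for t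
  proof (rule ccontr)
    assume "\<not> followed TYPE('n) P q0 t"
    then have "s \<le> t" unfolding s_def using that B(2) by (intro cInf_lower) (auto simp: B_def)
    then show False using that by simp
  qed
  have "followed TYPE('n) P q0 s"
  proof (cases "s = q0")
    case True
    then show ?thesis using followed_start[OF sys n] by simp
  next
    case False
    then show ?thesis using followed_left[OF sys n, of s] s below by simp
  qed
  then obtain \<sigma> :: "'n \<Rightarrow> nat" and x k A u c where "follows P q0 s \<sigma> x k A u c"
    unfolding followed_def by blast
  then obtain e where e: "0 < e" "\<And>t. s \<le> t \<Longrightarrow> t \<le> s + e \<Longrightarrow> follows P q0 t \<sigma> x k A u c"
    using follows_right[OF sys n s] by blast
  have "s + e \<le> t" if "t \<in> B" for t
  proof (rule ccontr)
    assume "\<not> s + e \<le> t"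
    then have "followed TYPE('n) P q0 t"
      using below[of t] e(2)[of t] that unfolding followed_def B_def by force
    then show False using that by (simp add: B_def)
  qed
  then have "s + e \<le> s" unfolding s_def using B(1) by (intro cInf_greatest) auto
  then show False using e(1) by simp
qed

section \<open>Passage to the limit and the numerical bound\<close>

lemma ex_approximating_direction:
  assumes sys: "n0_system CARD('n::finite) q0 P" and n: "2 \<le> CARD('n)"
  obtains u :: "real^'n" where "norm u = 1"
    "\<And>q j. q0 \<le> q \<Longrightarrow> 0 \<le> q \<Longrightarrow> 1 \<le> j \<Longrightarrow> j \<le> CARD('n) \<Longrightarrow>
       log_minimum u j q \<le> P j q + tolerance CARD('n)"
proof -
  note tol = tolerance_nonneg[where 'n='n]
  have "\<exists>u::real^'n. norm u = 1 \<and> (\<forall>t\<in>{q0..q0 + real N}. \<forall>j. 1 \<le> j \<and> j \<le> CARD('n) \<longrightarrow>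
      fits u j t (P j t + tolerance CARD('n)))" for N
  proof -
    have "followed TYPE('n) P q0 (q0 + real N)" by (rule followed_all[OF sys n]) simp
    then obtain \<sigma> :: "'n \<Rightarrow> nat" and x k A u c where f: "follows P q0 (q0 + real N) \<sigma> x k A u c"
      unfolding followed_def by blast
    moreover have "norm (u - u) \<le> radius k A c" by (simp add: radius_def)
    ultimately show ?thesis
      unfolding follows_def cell_state_def unit_normal_def by blast
  qed
  then obtain U :: "nat \<Rightarrow> real^'n" where U: "\<And>N. norm (U N) = 1"
    "\<And>N t j. q0 \<le> t \<Longrightarrow> t \<le> q0 + real N \<Longrightarrow> 1 \<le> j \<Longrightarrow> j \<le> CARD('n) \<Longrightarrow>
       fits (U N) j t (P j t + tolerance CARD('n))"
    by (metis atLeastAtMost_iff)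
  have "\<forall>N. U N \<in> sphere 0 1" using U(1) by simp
  then obtain u r where u: "u \<in> sphere 0 1" and r: "strict_mono r" and lim: "(U \<circ> r) \<longlonglongrightarrow> u"
    using compact_sphere[of 0 1] unfolding compact_def by blast
  have nu: "norm u = 1" using u by simp
  have "log_minimum u j q \<le> P j q + tolerance CARD('n)"
    if q: "q0 \<le> q" "0 \<le> q" and j: "1 \<le> j" "j \<le> CARD('n)" for q j
  proof (rule field_le_epsilon)
    fix d :: real assume d: "0 < d"
    \<comment> \<open>Tuned to make the loss in \<open>fits_perturb\<close> equal to
      \<open>ln (1 + d)\<close>, which is at most \<open>d\<close>.\<close>
    define \<eta> where "\<eta> = d / exp q"
    have "0 < \<eta>" using d by (simp add: \<eta>_def)
    then obtain M where M: "\<And>N. M \<le> N \<Longrightarrow> norm ((U \<circ> r) N - u) < \<eta>"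
      using LIMSEQ_D[OF lim] by blast
    obtain M' :: nat where M': "q - q0 \<le> real M'" using real_arch_simple by blast
    define N where "N = max M M'"
    have "real M' \<le> real N" by (simp add: N_def)
    also have "\<dots> \<le> real (r N)" using seq_suble[OF r, of N] by simp
    finally have "fits (U (r N)) j q (P j q + tolerance CARD('n))"
      using M' q j by (intro U(2)) auto
    moreover have "norm (u - U (r N)) \<le> \<eta>" using M[of N] by (simp add: N_def norm_minus_commute)
    ultimately have "fits u j q (P j q + tolerance CARD('n) + ln (1 + exp q * \<eta>))"
      by (rule fits_perturb)
    moreover have "exp q * \<eta> = d" by (simp add: \<eta>_def)
    moreover have "ln (1 + d) \<le> d" using ln_add_one_self_le_self[of d] d by simp
    ultimately have "fits u j q (P j q + tolerance CARD('n) + d)" by (auto intro: fits_mono)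
    moreover have "0 \<le> P j q" using n0_system_nonneg[OF sys n j q(1)] .
    ultimately show "log_minimum u j q \<le> P j q + tolerance CARD('n) + d"
      using tol d by (intro log_minimum(2)[OF nu j]) auto
  qed
  with nu show thesis by (rule that)
qed

text \<open>With 12 at most \<open>exp 3\<close> and \<open>ln 2\<close> at most 1, the claim
  divided by n becomes 14/5 n^2 + 15 n + 4 \<le> 3 n^2 + 27 n.\<close>

lemma tolerance_le:
  assumes "1 \<le> n"
  shows "real n * tolerance n + real n * ln 2 \<le> 3 * real n ^ 2 * (real n + 9)"
proof -
  have e: "12 \<le> exp (3::real)"
    using exp_ge_one_plus_x_over_n_power_n[of 12 "3::real"]
    by (simp add: power_divide)
  then have "8 * 12 ^ n \<le> exp 3 * exp (3::real) ^ n" by (intro mult_mono power_mono) auto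
  also have "\<dots> = exp (3 + 3 * real n)" by (simp add: exp_add exp_of_nat2_mult[symmetric] mult.commute)
  finally have "ln (8 * 12 ^ n) \<le> ln (exp (3 + 3 * real n))" by (intro ln_mono) auto
  then have "ln (8 * 12 ^ n) \<le> 3 + 3 * real n" by (simp only: ln_exp)
  moreover have "ln 2 \<le> (1::real)" using ln_add_one_self_le_self[of 1] by simp
  ultimately have "tolerance n + ln 2 \<le> 2 * width n + 4 + 3 * real n" by (simp add: tolerance_def)
  also have "\<dots> = 14 / 5 * real n ^ 2 + 15 * real n + 4"
    by (simp add: width_def spacing_def algebra_simps power2_eq_square)
  also have "\<dots> \<le> 3 * real n ^ 2 + 27 * real n"
    using assms zero_le_power2[of "real n"] by linarith
  also have "\<dots> = 3 * real n * (real n + 9)" by (simp add: algebra_simps power2_eq_square)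
  finally have "real n * (tolerance n + ln 2) \<le> real n * (3 * real n * (real n + 9))"
    by (intro mult_left_mono) auto
  then show ?thesis by (simp add: algebra_simps power2_eq_square)
qed

theorem theorem8p1:
  fixes P :: "nat \<Rightarrow> real \<Rightarrow> real" and q0 :: real
  assumes "CARD('n::finite) \<ge> 2"
    and "q0 \<ge> 0"
    and "n0_system CARD('n) q0 P"
  shows "\<exists>u :: real^'n. norm u = 1 \<and>
           (\<forall>q\<ge>q0. (MAX j\<in>{1..CARD('n)}. \<bar>P j q - log_minimum u j q\<bar>)
                     \<le> 3 * real CARD('n) ^ 2 * (real CARD('n) + 9))"
proof -
  let ?n = "CARD('n)"
  define E where "E = tolerance ?n"
  define C where "C = 3 * real ?n ^ 2 * (real ?n + 9)"
  have E0: "0 \<le> E" unfolding E_def by (rule tolerance_nonneg)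
  have C: "real ?n * E + real ?n * ln 2 \<le> C"
    unfolding E_def C_def using assms(1) by (intro tolerance_le) simp
  obtain u :: "real^'n" where u: "norm u = 1"
    and up: "\<And>q j. q0 \<le> q \<Longrightarrow> 0 \<le> q \<Longrightarrow> 1 \<le> j \<Longrightarrow> j \<le> ?n \<Longrightarrow> log_minimum u j q \<le> P j q + E"
    unfolding E_def by (rule ex_approximating_direction[OF assms(3,1)]) blast
  have "\<bar>P j q - log_minimum u j q\<bar> \<le> C" if q: "q0 \<le> q" and j: "1 \<le> j" "j \<le> ?n" for q j
  proof -
    have q': "0 \<le> q" using q assms(2) by simp
    let ?L = "\<lambda>i. log_minimum u i q"
    have "(\<Sum>i=1..?n. P i q) = q"
      using n0_systemD(5)[OF assms(3) q] by (simp add: psum_def)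
    then have "(\<Sum>i=1..?n. P i q - ?L i) \<le> real ?n * ln 2"
      using sum_log_minimum[OF u q'] by (simp add: sum_subtractf)
    moreover have "(\<Sum>i=1..?n. P i q - ?L i) = (P j q - ?L j) + (\<Sum>i\<in>{1..?n} - {j}. P i q - ?L i)"
      using j by (intro sum.remove) simp_all
    ultimately have "(P j q - ?L j) + (\<Sum>i\<in>{1..?n} - {j}. P i q - ?L i) \<le> real ?n * ln 2"
      by linarith
    \<comment> \<open>The upper bounds for the other n - 1 minima turn the bound on the sum into one
      for the single index \<open>j\<close>.\<close>
    moreover have "(\<Sum>i\<in>{1..?n} - {j}. - E) \<le> (\<Sum>i\<in>{1..?n} - {j}. P i q - ?L i)"
    proof (rule sum_mono)
      fix i assume "i \<in> {1..?n} - {j}"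
      then show "- E \<le> P i q - ?L i" using up[OF q q', of i] by simp
    qed
    moreover have "(\<Sum>i\<in>{1..?n} - {j}. - E) = - (real (?n - 1) * E)" using j by simp
    moreover have "real (?n - 1) * E \<le> real ?n * E" using E0 by (intro mult_right_mono) auto
    ultimately have "P j q - ?L j \<le> C" using C by linarith
    moreover have "?L j - P j q \<le> C"
    proof -
      have "1 * E \<le> real ?n * E" using E0 assms(1) by (intro mult_right_mono) auto
      moreover have "0 \<le> real ?n * ln 2" by simp
      ultimately show ?thesis using up[OF q q' j] C by linarith
    qed
    ultimately show ?thesis by linarith
  qed
  then have "\<forall>q\<ge>q0. (MAX j\<in>{1..?n}. \<bar>P j q - log_minimum u j q\<bar>) \<le> C"
    using assms(1) by (auto intro!: Max.boundedI)
  with u show ?thesis unfolding C_def by blast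
qed

end
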